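(* For all primes $p>3$, \[ \sum_{x=0}^{p-1}\, {}_3F_2\left[\begin{matrix}\frac{1-p}{2} & \frac{1+p}{2} & -x\\ & 1 & 1\end{matrix}\;;\;1\right]^2 \equiv (-1)^{\frac{p-1}{2}} \pmod{p^3}, \] and for all primes $p\ge 3$, \[ \sum_{x=0}^{p-1}\, {}_3F_2\left[\begin{matrix}\frac12 & \frac12 & -x\\ & 1 & 1\end{matrix}\;;\;1\right]^2 \equiv (-1)^{\frac{p-1}{2}} \pmod{p^3}. \]
   Context: For $a\in\mathbb{C}$, $(a)_0:=1$ and $(a)_k:=a(a+1)\cdots(a+k-1)$ for $k\ge 1$. The hypergeometric series is \[ {}_3F_2\left[\begin{matrix}\alpha_1 & \alpha_2 & \alpha_3\\ & \beta_1 & \beta_2\end{matrix}\;;\;\lambda\right]:=\sum_{k=0}^{\infty}\frac{(\alpha_1)_k(\alpha_2)_k(\alpha_3)_k}{(\beta_1)_k(\beta_2)_k}\cdot\frac{\lambda^k}{k!}. \] Since one upper parameter is $-x$ with $x$ a nonnegative integer, the series above are finite sums (only terms with $k\le x$ contribute) and take rational values; for instance \[ {}_3F_2\left[\begin{matrix}\frac12 & \frac12 & -x\\ & 1 & 1\end{matrix}\;;\;1\right]=\sum_{k=0}^{x}(-1)^k\binom{-\frac12}{k}^2\binom{x}{k}. \] A congruence $a\equiv b\pmod{p^s}$ between rational numbers means $a-b\in p^s\mathbb{Z}_p$, where $\mathbb{Z}_p$ is the ring of $p$-adic integers (equivalently, $a-b$ is $p^s$ times a rational number whose denominator is prime to $p$).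 *)

theory Defs
  imports Complex_Main "HOL-Computational_Algebra.Primes"
begin

definition hyp3F2 ::
  "complex \<Rightarrow> complex \<Rightarrow> complex \<Rightarrow> complex \<Rightarrow> complex \<Rightarrow> complex \<Rightarrow> complex" where
  "hyp3F2 a1 a2 a3 b1 b2 z =
     (\<Sum>k. (pochhammer a1 k * pochhammer a2 k * pochhammer a3 k) /
           (pochhammer b1 k * pochhammer b2 k) * (z ^ k / fact k))"

text \<open>
  Congruence of rational numbers modulo the \<open>s\<close>-th power of a prime \<open>p\<close>:
  the difference is \<open>p ^ s\<close> times a rational whose denominator is prime to \<open>p\<close>,
  i.e. it lies in \<open>p ^ s \<int>\<^sub>p\<close>. The rationals are taken inside the complex numbers because
  the hypergeometric series are complex.
\<close>

definition rat_cong :: "nat \<Rightarrow> nat \<Rightarrow> complex \<Rightarrow> complex \<Rightarrow> bool" where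
  "rat_cong p s a b \<longleftrightarrow> a \<in> \<rat> \<and> b \<in> \<rat> \<and>
     (\<exists>m n :: int. n \<noteq> 0 \<and> coprime n (int p) \<and>
        a - b = of_nat p ^ s * (of_int m / of_int n))"

lemma hyp3F2_terminating:
  "hyp3F2 a1 a2 (- of_nat x) b1 b2 z =
     (\<Sum>k\<le>x. (pochhammer a1 k * pochhammer a2 k * pochhammer (- of_nat x) k) /
           (pochhammer b1 k * pochhammer b2 k) * (z ^ k / fact k))"
  unfolding hyp3F2_def
  by (rule suminf_finite) (auto simp: pochhammer_of_nat_eq_0_lemma)

end

theory Submission
  imports Defs
begin

text \<open>
  Put \<open>m = a (a + 1)\<close>. The series \<open>\<^sub>3F\<^sub>2(-a, a + 1, -x; 1, 1; 1)\<close> is a polynomial \<open>S\<^sub>m x\<close> in \<open>m\<close> which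
  satisfies a self-adjoint difference equation in \<open>x\<close> with eigenvalue \<open>m\<close>. Writing \<open>T\<close> for the
  derivative of \<open>S\<close> with respect to \<open>m\<close>, summation by parts gives the exact formula
  \<open>(\<Sum>x<N. (S x)\<^sup>2) = N\<^sup>2 (T N * S (N - 1) - S N * T (N - 1))\<close>. At \<open>N = p\<close> only \<open>S (p - 1)\<close> modulo
  \<open>p\<^sup>3\<close>, \<open>T (p - 1)\<close> modulo \<open>p\<close> and the coefficient of index \<open>p\<close> in \<open>T p\<close> matter. For
  \<open>m = n (n + 1)\<close>, \<open>n = (p - 1) / 2\<close>, all three are expressed by \<open>\<Sum>1/k\<close> and \<open>\<Sum>(-1)\<^sup>k/k\<^sup>2\<close> over
  \<open>1 \<le> k \<le> n\<close>, and these contributions cancel. The second congruence is the case \<open>m = -1/4\<close>, which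
  differs from the first parameter by \<open>p\<^sup>2/4\<close>; the change is invisible modulo \<open>p\<^sup>3\<close> when \<open>p > 3\<close>
  because the sum of the inverse squares modulo \<open>p\<close> vanishes.
\<close>

section \<open>The terminating series and its recurrences\<close>

text \<open>Since \<open>a (a + 1) - j (j + 1) = (a - j) (a + 1 + j)\<close>, the value at
  \<open>m = a (a + 1)\<close> is the product of the binomial coefficients \<open>a choose k\<close>
  and \<open>(a + k) choose k\<close>. As a polynomial in \<open>m\<close> it is visibly invariant
  under \<open>a\<close> to \<open>- a - 1\<close> and can be differentiated in
  \<open>m\<close>.\<close>

definition hcoeff :: "'a::field_char_0 \<Rightarrow> nat \<Rightarrow> 'a" where
  "hcoeff m k = (\<Prod>j<k. m - of_nat (j * (j + 1))) / (fact k)\<^sup>2"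

text \<open>The formal derivative in \<open>m\<close> by the product rule. Omitting a factor instead
  of dividing by it keeps the formula valid at a zero of the product, as is needed at
  \<open>half_param\<close>.\<close>

definition hcoeff_deriv :: "'a::field_char_0 \<Rightarrow> nat \<Rightarrow> 'a" where
  "hcoeff_deriv m k = (\<Sum>i<k. \<Prod>j\<in>{..<k} - {i}. m - of_nat (j * (j + 1))) / (fact k)\<^sup>2"

definition binsum :: "(nat \<Rightarrow> 'a::field_char_0) \<Rightarrow> nat \<Rightarrow> 'a" where
  "binsum c x = (\<Sum>k\<le>x. c k * of_nat (x choose k))"

lemma hcoeff_0 [simp]: "hcoeff m 0 = 1"
  by (simp add: hcoeff_def)

lemma hcoeff_at_0: "hcoeff 0 k = (if k = 0 then 1 else 0)"
  by (cases k) (auto simp: hcoeff_def lessThan_Suc_eq_insert_0)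

lemma hcoeff_deriv_0 [simp]: "hcoeff_deriv m 0 = 0"
  by (simp add: hcoeff_deriv_def)

lemma hcoeff_Suc:
  "of_nat (Suc k) ^ 2 * hcoeff m (Suc k) = (m - of_nat (k * (k + 1))) * hcoeff m k"
proof -
  have "of_nat (Suc k) \<noteq> (0::'a)" "fact k \<noteq> (0::'a)" by (simp_all del: of_nat_Suc)
  then show ?thesis
    by (simp add: hcoeff_def field_simps power2_eq_square del: of_nat_Suc)
qed

lemma sum_prod_remove_insert:
  fixes f :: "'b \<Rightarrow> 'a::comm_semiring_1"
  assumes "finite J" "x \<notin> J"
  shows "(\<Sum>i\<in>insert x J. \<Prod>j\<in>insert x J - {i}. f j) =
    (\<Prod>j\<in>J. f j) + f x * (\<Sum>i\<in>J. \<Prod>j\<in>J - {i}. f j)"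
proof -
  have "(\<Prod>j\<in>insert x J - {i}. f j) = f x * (\<Prod>j\<in>J - {i}. f j)" if "i \<in> J" for i
  proof -
    have "insert x J - {i} = insert x (J - {i})" using assms that by auto
    then show ?thesis using assms by simp
  qed
  then show ?thesis using assms by (simp add: sum_distrib_left)
qed

lemma hcoeff_deriv_Suc:
  "of_nat (Suc k) ^ 2 * hcoeff_deriv m (Suc k) =
     (m - of_nat (k * (k + 1))) * hcoeff_deriv m k + hcoeff m k"
proof -
  define f where "f j = m - of_nat (j * (j + 1))" for j
  have *: "(\<Sum>i<Suc k. \<Prod>j\<in>{..<Suc k} - {i}. f j) =
        (\<Prod>j<k. f j) + f k * (\<Sum>i<k. \<Prod>j\<in>{..<k} - {i}. f j)"
    unfolding lessThan_Suc by (rule sum_prod_remove_insert) auto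
  have "of_nat (Suc k) \<noteq> (0::'a)" "fact k \<noteq> (0::'a)" by (simp_all del: of_nat_Suc)
  then show ?thesis
    using * unfolding hcoeff_def hcoeff_deriv_def f_def[symmetric]
    by (simp add: field_simps power2_eq_square del: of_nat_Suc sum.lessThan_Suc)
qed

section \<open>The difference equation in \<open>x\<close> and the exact sum of squares\<close>

lemma binsum_extend:
  assumes "x \<le> M" shows "binsum c x = (\<Sum>k\<le>M. c k * of_nat (x choose k))"
  unfolding binsum_def using assms by (intro sum.mono_neutral_left) auto

lemma binsum_hcoeff_at_0: "binsum (hcoeff 0) x = 1"
  by (simp add: binsum_def hcoeff_at_0 if_distrib[of "\<lambda>c. c * _"] cong: if_cong)

text \<open>The difference operator is triangular on binomial coefficients: Pascal's rule and
  absorption leave only the indices \<open>k\<close> and \<open>k - 1\<close>. The truncated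
  \<open>x - 1\<close> at \<open>x = 0\<close> and \<open>k - 1\<close> at \<open>k = 0\<close> are
  multiplied by zero.\<close>

lemma binomial_diff_operator:
  fixes x k :: nat
  shows "of_nat (x + 1) ^ 2 * (of_nat (Suc x choose k) - of_nat (x choose k)) -
         of_nat x ^ 2 * (of_nat (x choose k) - of_nat ((x - 1) choose k)) =
         (of_nat (k * (k + 1)) * of_nat (x choose k) +
         of_nat k ^ 2 * of_nat (x choose (k - 1)) :: 'a::field_char_0)"
proof (cases k)
  case 0
  then show ?thesis by simp
next
  case (Suc l)
  have "x * ((x - 1) choose l) = Suc l * (x choose Suc l)"
    by (cases x) (simp_all add: Suc_times_binomial del: binomial_Suc_Suc mult_Suc_right mult_Suc)
  then have 1: "of_nat x * of_nat ((x - 1) choose l) = (of_nat (Suc l) * of_nat (x choose Suc l) :: 'a)"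
    by (metis of_nat_mult)
  have "Suc x * (x choose l) = Suc l * (Suc x choose Suc l)"
    by (simp add: Suc_times_binomial del: binomial_Suc_Suc mult_Suc_right mult_Suc)
  then have 2: "of_nat (Suc x) * of_nat (x choose l) =
      (of_nat (Suc l) * (of_nat (x choose l) + of_nat (x choose Suc l)) :: 'a)"
    by (metis of_nat_mult of_nat_add binomial_Suc_Suc)
  have 3: "of_nat x ^ 2 * (of_nat (x choose Suc l) - of_nat ((x - 1) choose Suc l)) =
      (of_nat x ^ 2 * of_nat ((x - 1) choose l) :: 'a)"
    by (cases x) simp_all
  have "of_nat (x + 1) ^ 2 * (of_nat (Suc x choose k) - of_nat (x choose k)) -
         of_nat x ^ 2 * (of_nat (x choose k) - of_nat ((x - 1) choose k)) =
     (of_nat (Suc x) * (of_nat (Suc x) * of_nat (x choose l)) -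
      of_nat x * (of_nat x * of_nat ((x - 1) choose l)) :: 'a)"
    unfolding Suc 3 by (simp add: power2_eq_square algebra_simps)
  also have "\<dots> = of_nat (k * (k + 1)) * of_nat (x choose k) +
         of_nat k ^ 2 * of_nat (x choose (k - 1))"
    unfolding 1 2 using 2 unfolding Suc
    by (simp add: power2_eq_square) algebra
  finally show ?thesis .
qed

text \<open>The inhomogeneous term \<open>d\<close> lets one lemma serve both series:
  \<open>d = 0\<close> for \<open>S\<close>, and \<open>d = hcoeff m\<close> for its derivative in
  \<open>m\<close>.\<close>

lemma binsum_recurrence:
  fixes c d :: "nat \<Rightarrow> 'a::field_char_0"
  assumes "\<And>k. of_nat (Suc k) ^ 2 * c (Suc k) = (m - of_nat (k * (k + 1))) * c k + d k"
  shows "of_nat (x + 1) ^ 2 * (binsum c (Suc x) - binsum c x) -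
         of_nat x ^ 2 * (binsum c x - binsum c (x - 1)) = m * binsum c x + binsum d x"
proof -
  let ?b = "\<lambda>y k. of_nat (y choose k) :: 'a"
  have "of_nat (x + 1) ^ 2 * (binsum c (Suc x) - binsum c x) -
         of_nat x ^ 2 * (binsum c x - binsum c (x - 1)) =
     (\<Sum>k\<le>Suc x. c k * (of_nat (x + 1) ^ 2 * (?b (Suc x) k - ?b x k) -
         of_nat x ^ 2 * (?b x k - ?b (x - 1) k)))"
    using binsum_extend[of "Suc x" "Suc x" c] binsum_extend[of x "Suc x" c]
      binsum_extend[of "x - 1" "Suc x" c]
    by (simp only: le_refl le_SucI diff_le_self le_trans[OF diff_le_self le_SucI]
        sum_subtractf[symmetric] sum_distrib_left right_diff_distrib mult.left_commute simp_thms)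
  also have "\<dots> = (\<Sum>k\<le>Suc x. c k * (of_nat (k * (k + 1)) * ?b x k)) +
      (\<Sum>k\<le>Suc x. c k * (of_nat k ^ 2 * ?b x (k - 1)))"
    unfolding binomial_diff_operator by (simp only: distrib_left sum.distrib)
  \<comment> \<open>The term \<open>k = 0\<close> vanishes through \<open>k ^ 2\<close>, so the
    index can be shifted; this brings in \<open>c (Suc k)\<close> and with it the assumed
    recurrence.\<close>
  also have "(\<Sum>k\<le>Suc x. c k * (of_nat k ^ 2 * ?b x (k - 1))) =
      (\<Sum>k\<le>x. of_nat (Suc k) ^ 2 * c (Suc k) * ?b x k)"
    by (subst sum.atMost_Suc_shift) (simp add: mult_ac)
  also have "\<dots> = (\<Sum>k\<le>x. ((m - of_nat (k * (k + 1))) * c k + d k) * ?b x k)"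
    unfolding assms ..
  also have "(\<Sum>k\<le>Suc x. c k * (of_nat (k * (k + 1)) * ?b x k)) =
      (\<Sum>k\<le>x. c k * (of_nat (k * (k + 1)) * ?b x k))"
    by simp
  finally show ?thesis
    by (simp add: binsum_def sum_distrib_left sum.distrib[symmetric] algebra_simps)
qed

text \<open>The bracket is a discrete Wronskian. \<open>S x\<close> times the equation for
  \<open>T\<close> minus \<open>T x\<close> times the equation for \<open>S\<close> removes
  \<open>m\<close> and shows \<open>(S x)^2\<close> to be the increment of the right-hand
  side.\<close>

lemma christoffel_darboux:
  fixes m :: "'a::field_char_0"
  defines "S \<equiv> binsum (hcoeff m)" and "T \<equiv> binsum (hcoeff_deriv m)"
  shows "(\<Sum>x<N. (S x)\<^sup>2) = of_nat N ^ 2 * (T N * S (N - 1) - S N * T (N - 1))"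
proof (induction N)
  case 0
  then show ?case by simp
next
  case (Suc x)
  have S: "of_nat (x + 1) ^ 2 * (S (Suc x) - S x) - of_nat x ^ 2 * (S x - S (x - 1)) = m * S x"
    using binsum_recurrence[of "hcoeff m" m "\<lambda>_. 0" x] hcoeff_Suc[of _ m]
    by (simp add: S_def binsum_def del: of_nat_Suc)
  have T: "of_nat (x + 1) ^ 2 * (T (Suc x) - T x) - of_nat x ^ 2 * (T x - T (x - 1)) = m * T x + S x"
    unfolding S_def T_def by (rule binsum_recurrence) (rule hcoeff_deriv_Suc)
  have "(\<Sum>y<Suc x. (S y)\<^sup>2) = of_nat x ^ 2 * (T x * S (x - 1) - S x * T (x - 1)) + (S x)\<^sup>2"
    using Suc by simp
  also have "\<dots> = of_nat (x + 1) ^ 2 * (T (Suc x) * S x - S (Suc x) * T x)"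
    using S T by algebra
  finally show ?case by simp
qed

text \<open>The condition \<open>a + b = 1\<close> turns \<open>(a + j) (b + j)\<close> into
  \<open>a b + j (j + 1)\<close>, so the two parameters enter only through their product. The signs
  \<open>(-1)^k\<close> from this product and from the third parameter cancel.\<close>

lemma hyp3F2_eq_binsum:
  assumes "a + b = 1"
  shows "hyp3F2 a b (- of_nat x) 1 1 1 = binsum (hcoeff (- a * b)) x"
proof -
  have "(pochhammer a k * pochhammer b k * pochhammer (- of_nat x) k) /
           (pochhammer 1 k * pochhammer 1 k) * (1 ^ k / fact k) =
      hcoeff (- a * b) k * of_nat (x choose k)" for k
  proof -
    have "(a + of_nat j) * (b + of_nat j) = - (- a * b - of_nat (j * (j + 1)))" for j
    proof -
      have "(a + of_nat j) * (b + of_nat j) = a * b + (a + b) * of_nat j + of_nat j * of_nat j"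
        by (simp add: algebra_simps)
      then show ?thesis by (simp add: assms algebra_simps)
    qed
    then have "pochhammer a k * pochhammer b k = (\<Prod>j<k. - (- a * b - of_nat (j * (j + 1))))"
      by (simp add: pochhammer_prod atLeast0LessThan prod.distrib[symmetric])
    also have "\<dots> = (-1) ^ k * (\<Prod>j<k. - a * b - of_nat (j * (j + 1)))"
      by (subst prod_uminus) simp
    finally have 1: "pochhammer a k * pochhammer b k =
      (-1) ^ k * (\<Prod>j<k. - a * b - of_nat (j * (j + 1)))" .
    have 2: "pochhammer (- of_nat x) k = (-1) ^ k * fact k * (of_nat (x choose k) :: complex)"
      by (simp add: binomial_gbinomial gbinomial_pochhammer)
    show ?thesis
      unfolding hcoeff_def 1 2
      by (simp add: pochhammer_fact[symmetric] power2_eq_square mult_ac flip: power_add)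
  qed
  then show ?thesis
    by (simp add: hyp3F2_terminating binsum_def)
qed

section \<open>Contiguous relations in the parameter \<open>a\<close>\<close>

text \<open>The factors \<open>a - j\<close> and \<open>a + 1 + j\<close> of the two products
  overlap except at the ends. Induction avoids a division by \<open>a + 1\<close>, which may
  vanish.\<close>

lemma hcoeff_Suc_shift_up:
  "of_nat (Suc k) ^ 2 * hcoeff ((a + 1) * (a + 2)) (Suc k) =
     (a + 2 + of_nat k) * (a + 1 + of_nat k) * hcoeff (a * (a + 1)) k"
proof (induction k)
  case 0
  then show ?case using hcoeff_Suc[of 0 "(a + 1) * (a + 2)"] by (simp add: algebra_simps)
next
  case (Suc k)
  have 1: "of_nat (Suc (Suc k)) ^ 2 * hcoeff ((a + 1) * (a + 2)) (Suc (Suc k)) =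
      ((a + 1) * (a + 2) - of_nat (Suc k * (Suc k + 1))) * hcoeff ((a + 1) * (a + 2)) (Suc k)"
    by (rule hcoeff_Suc)
  have 2: "of_nat (Suc k) ^ 2 * hcoeff (a * (a + 1)) (Suc k) =
      (a * (a + 1) - of_nat (k * (k + 1))) * hcoeff (a * (a + 1)) k"
    by (rule hcoeff_Suc)
  have "of_nat (Suc k) ^ 2 * (of_nat (Suc (Suc k)) ^ 2 * hcoeff ((a + 1) * (a + 2)) (Suc (Suc k))) =
    of_nat (Suc k) ^ 2 * ((a + 2 + of_nat (Suc k)) * (a + 1 + of_nat (Suc k)) * hcoeff (a * (a + 1)) (Suc k))"
    unfolding 1 using 2 Suc by (simp only: of_nat_mult of_nat_add of_nat_Suc of_nat_1) algebra
  then show ?case by (subst (asm) mult_cancel_left) (simp del: of_nat_Suc)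
qed

text \<open>The reflection \<open>a\<close> to \<open>- a - 1\<close> fixes \<open>a (a + 1)\<close>
  and turns the upward shift into the downward one.\<close>

lemma hcoeff_Suc_shift_down:
  "of_nat (Suc k) ^ 2 * hcoeff ((a - 1) * a) (Suc k) =
     (a - 1 - of_nat k) * (a - of_nat k) * hcoeff (a * (a + 1)) k"
  using hcoeff_Suc_shift_up[of k "- a - 1"] by (simp add: algebra_simps)

text \<open>After multiplication by \<open>(Suc k)^2\<close> every coefficient of index
  \<open>Suc k\<close> is a multiple of \<open>hcoeff (a * (a + 1)) k\<close>, and a polynomial
  identity in \<open>a\<close> and \<open>k\<close> remains.\<close>

lemma hcoeff_recurrence:
  fixes a :: "'a::field_char_0"
  shows "(a + 1)\<^sup>2 * hcoeff ((a + 1) * (a + 2)) (Suc k) - a\<^sup>2 * hcoeff ((a - 1) * a) (Suc k) =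
     (2 * a + 1) * ((2 * of_nat (Suc k) + 1) * hcoeff (a * (a + 1)) (Suc k) +
        2 * of_nat (Suc k) * hcoeff (a * (a + 1)) k)"
proof -
  have "of_nat (Suc k) ^ 2 * ((a + 1)\<^sup>2 * hcoeff ((a + 1) * (a + 2)) (Suc k) -
      a\<^sup>2 * hcoeff ((a - 1) * a) (Suc k)) =
    of_nat (Suc k) ^ 2 * ((2 * a + 1) * ((2 * of_nat (Suc k) + 1) * hcoeff (a * (a + 1)) (Suc k) +
        2 * of_nat (Suc k) * hcoeff (a * (a + 1)) k))"
    using hcoeff_Suc_shift_up[of k a] hcoeff_Suc_shift_down[of k a] hcoeff_Suc[of k "a * (a + 1)"]
    by (simp only: of_nat_mult of_nat_add of_nat_Suc of_nat_1) algebra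
  then show ?thesis by (subst (asm) mult_cancel_left) (simp del: of_nat_Suc)
qed

text \<open>This moves between neighbouring values of \<open>a\<close> with \<open>x\<close> fixed;
  at \<open>x = p - 1\<close> it computes \<open>S\<close> inductively from \<open>a = 0\<close>.
  The fact \<open>abs\<close> absorbs the factor \<open>x\<close> into a shift of \<open>k\<close>,
  which matches the recurrence of the coefficients.\<close>

lemma binsum_param_recurrence:
  fixes a :: "'a::field_char_0"
  shows "(a + 1)\<^sup>2 * binsum (hcoeff ((a + 1) * (a + 2))) x =
     (2 * a + 1) * (2 * of_nat x + 1) * binsum (hcoeff (a * (a + 1))) x +
     a\<^sup>2 * binsum (hcoeff ((a - 1) * a)) x"
proof -
  let ?b = "\<lambda>k. of_nat (x choose k) :: 'a" and ?A = "hcoeff (a * (a + 1))"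
  let ?D = "\<lambda>k. (a + 1)\<^sup>2 * hcoeff ((a + 1) * (a + 2)) k - a\<^sup>2 * hcoeff ((a - 1) * a) k"
  have abs: "of_nat x * ?b k = of_nat k * ?b k + of_nat (Suc k) * ?b (Suc k)" for k
  proof -
    have "x * (x choose k) = k * (x choose k) + Suc k * (x choose Suc k)"
    proof (cases "k \<le> x")
      case True
      have "(x - k) * (x choose k) = Suc k * (x choose Suc k)"
        using binomial_absorb_comp[of x k] binomial_absorption[of k "x"]
        by (metis binomial_absorb_comp binomial_absorption)
      with True show ?thesis
        by (metis add_mult_distrib le_add_diff_inverse)
    qed (simp add: binomial_eq_0)
    then show ?thesis by (metis of_nat_add of_nat_mult)
  qed
  have "(2 * of_nat x + 1) * binsum ?A x =
      (\<Sum>k\<le>x. (2 * of_nat k + 1) * ?A k * ?b k) + (\<Sum>k\<le>x. 2 * of_nat (Suc k) * ?A k * ?b (Suc k))"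
    unfolding binsum_def sum_distrib_left sum.distrib[symmetric]
  proof (rule sum.cong[OF refl])
    fix k
    show "(2 * of_nat x + 1) * (?A k * ?b k) =
      (2 * of_nat k + 1) * ?A k * ?b k + 2 * of_nat (Suc k) * ?A k * ?b (Suc k)"
      using abs[of k] by algebra
  qed
  also have "(\<Sum>k\<le>x. (2 * of_nat k + 1) * ?A k * ?b k) =
     (\<Sum>k\<le>Suc x. (2 * of_nat k + 1) * ?A k * ?b k)" by simp
  also have "\<dots> = 1 + (\<Sum>k\<le>x. (2 * of_nat (Suc k) + 1) * ?A (Suc k) * ?b (Suc k))"
    by (subst sum.atMost_Suc_shift) simp
  finally have "(2 * a + 1) * ((2 * of_nat x + 1) * binsum ?A x) = (2 * a + 1) +
     (\<Sum>k\<le>x. (2 * a + 1) * ((2 * of_nat (Suc k) + 1) * ?A (Suc k) + 2 * of_nat (Suc k) * ?A k) * ?b (Suc k))"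
    by (simp add: sum_distrib_left sum.distrib[symmetric] algebra_simps del: of_nat_Suc)
  \<comment> \<open>The separate \<open>2 * a + 1\<close> is \<open>?D 0\<close>, because
    \<open>(a + 1)^2 - a^2 = 2 a + 1\<close>.\<close>
  also have "\<dots> = ?D 0 * ?b 0 + (\<Sum>k\<le>x. ?D (Suc k) * ?b (Suc k))"
    unfolding hcoeff_recurrence by (simp add: power2_eq_square algebra_simps)
  also have "\<dots> = (\<Sum>k\<le>Suc x. ?D k * ?b k)"
    by (subst sum.atMost_Suc_shift) simp
  also have "\<dots> = (a + 1)\<^sup>2 * binsum (hcoeff ((a + 1) * (a + 2))) x - a\<^sup>2 * binsum (hcoeff ((a - 1) * a)) x"
    by (simp add: binsum_def sum_distrib_left sum_subtractf[symmetric] algebra_simps)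
  finally show ?thesis by (simp add: algebra_simps)
qed

section \<open>Alternating sums of the coefficients\<close>

text \<open>For \<open>K = p - 1\<close> the signs are the residues modulo \<open>p\<close> of the
  binomial coefficients in \<open>binsum\<close>, and unlike \<open>binsum\<close> this sum obeys a
  first-order recurrence in \<open>a\<close>.\<close>

definition altsum :: "nat \<Rightarrow> 'a::field_char_0 \<Rightarrow> 'a" where
  "altsum K a = (\<Sum>k\<le>K. (-1) ^ k * hcoeff (a * (a + 1)) k)"

text \<open>The product of \<open>1 - a^2 / j^2\<close> over \<open>1 \<le> j \<le> K\<close>, a
  truncation of Euler's product for the sine.\<close>

definition sqprod :: "nat \<Rightarrow> 'a::field_char_0 \<Rightarrow> 'a" where
  "sqprod K a = (\<Prod>j=1..K. of_nat j ^ 2 - a\<^sup>2) / (fact K)\<^sup>2"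

lemma sqprod_Suc:
  "of_nat (Suc K) ^ 2 * sqprod (Suc K) a = (of_nat (Suc K) ^ 2 - a\<^sup>2) * sqprod K a"
proof -
  have "of_nat (Suc K) \<noteq> (0::'a)" "fact K \<noteq> (0::'a)" by (simp_all del: of_nat_Suc)
  then show ?thesis
    by (simp add: sqprod_def field_simps power2_eq_square del: of_nat_Suc)
qed

text \<open>The factors \<open>a - j\<close> and \<open>a + 1 + j\<close> with
  \<open>j \<le> K\<close> pair up to \<open>a^2 - j^2\<close> for \<open>1 \<le> j \<le> K\<close>,
  leaving \<open>a\<close> and \<open>a + K + 1\<close>.\<close>

lemma hcoeff_Suc_sqprod:
  fixes a :: "'a::field_char_0"
  shows "of_nat (Suc K) ^ 2 * ((-1) ^ Suc K * hcoeff (a * (a + 1)) (Suc K)) =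
     - a * (a + of_nat (Suc K)) * sqprod K a"
proof (induction K)
  case 0
  then show ?case using hcoeff_Suc[of 0 "a * (a + 1)"] by (simp add: sqprod_def)
next
  case (Suc K)
  define e :: 'a where "e = (-1) ^ Suc K"
  have "of_nat (Suc K) ^ 2 * (of_nat (Suc (Suc K)) ^ 2 * ((- e) * hcoeff (a * (a + 1)) (Suc (Suc K)))) =
    of_nat (Suc K) ^ 2 * (- a * (a + of_nat (Suc (Suc K))) * sqprod (Suc K) a)"
    using hcoeff_Suc[of "Suc K" "a * (a + 1)"] sqprod_Suc[of K a] Suc[folded e_def]
    by (simp only: of_nat_mult of_nat_add of_nat_Suc of_nat_1) algebra
  then show ?case by (subst (asm) mult_cancel_left) (simp add: e_def del: of_nat_Suc)
qed

lemma altsum_recurrence: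
  fixes a :: "'a::field_char_0"
  shows "altsum K a + altsum K (a - 1) = 2 * sqprod K a"
proof (induction K)
  case 0
  then show ?case by (simp add: altsum_def sqprod_def)
next
  case (Suc K)
  \<comment> \<open>\<open>sqprod\<close> is even in \<open>a\<close>, so rewriting the parameter of
    \<open>a - 1\<close> through \<open>- a\<close> makes both new terms multiples of the same
    \<open>sqprod K a\<close>.\<close>
  have m: "(a - 1) * (a - 1 + 1) = (- a) * (- a + 1)" by (simp add: algebra_simps)
  define u where "u = (-1) ^ Suc K * hcoeff (a * (a + 1)) (Suc K)"
  define v where "v = (-1) ^ Suc K * hcoeff ((- a) * (- a + 1)) (Suc K)"
  have u: "of_nat (Suc K) ^ 2 * u = - a * (a + of_nat (Suc K)) * sqprod K a"
    unfolding u_def by (rule hcoeff_Suc_sqprod)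
  have v: "of_nat (Suc K) ^ 2 * v = a * (- a + of_nat (Suc K)) * sqprod K a"
    unfolding v_def using hcoeff_Suc_sqprod[of K "- a"] by (simp add: sqprod_def)
  have "altsum (Suc K) a + altsum (Suc K) (a - 1) = 2 * sqprod K a + u + v"
    using Suc by (simp only: altsum_def sum.atMost_Suc u_def v_def m) (simp add: algebra_simps)
  then have "of_nat (Suc K) ^ 2 * (altsum (Suc K) a + altsum (Suc K) (a - 1)) =
      of_nat (Suc K) ^ 2 * (2 * sqprod (Suc K) a)"
    using u v sqprod_Suc[of K a] by algebra
  then show ?case by (subst (asm) mult_cancel_left) (simp del: of_nat_Suc)
qed

text \<open>The shift carries the linear factors \<open>j - a\<close> and \<open>j + a\<close> onto
  one another except at the ends; clearing denominators also covers their zeros.\<close>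

lemma sqprod_shift:
  fixes a :: "'a::field_char_0"
  shows "(a + 1) * (a - of_nat K) * sqprod K (a + 1) = a * (a + 1 + of_nat K) * sqprod K a"
proof (induction K)
  case 0
  then show ?case by (simp add: sqprod_def)
next
  case (Suc K)
  have "of_nat (Suc K) ^ 2 * ((a + 1) * (a - of_nat (Suc K)) * sqprod (Suc K) (a + 1)) =
     of_nat (Suc K) ^ 2 * (a * (a + 1 + of_nat (Suc K)) * sqprod (Suc K) a)"
    using sqprod_Suc[of K a] sqprod_Suc[of K "a + 1"] Suc
    by (simp only: of_nat_Suc) algebra
  then show ?case by (subst (asm) mult_cancel_left) (simp del: of_nat_Suc)
qed

text \<open>\<open>sqprod K\<close> vanishes at \<open>1, ..., K\<close>, so by
  \<open>altsum_recurrence\<close> the value only changes sign from one integer to the next.\<close>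

lemma altsum_of_nat:
  assumes "r \<le> K" shows "altsum K (of_nat r :: 'a::field_char_0) = (-1) ^ r"
  using assms
proof (induction r)
  case 0
  then show ?case by (simp add: altsum_def hcoeff_at_0 if_distrib[of "(*) _"] cong: if_cong)
next
  case (Suc r)
  have "sqprod K (of_nat (Suc r) :: 'a) = 0"
    using Suc.prems by (auto simp: sqprod_def intro!: bexI[of _ "Suc r"])
  then show ?case
    using altsum_recurrence[of K "of_nat (Suc r) :: 'a"] Suc by (simp add: add_eq_0_iff)
qed

lemma sum_prod_remove:
  fixes f :: "'b \<Rightarrow> 'a::field_char_0"
  assumes "finite J" "\<And>i. i \<in> J \<Longrightarrow> f i \<noteq> 0"
  shows "(\<Sum>i\<in>J. \<Prod>j\<in>J - {i}. f j) = (\<Prod>j\<in>J. f j) * (\<Sum>i\<in>J. 1 / f i)"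
proof -
  have "(\<Prod>j\<in>J - {i}. f j) = (\<Prod>j\<in>J. f j) * (1 / f i)" if "i \<in> J" for i
    using assms that by (simp add: prod.remove[of J i])
  then show ?thesis by (simp add: sum_distrib_left)
qed

section \<open>Congruences in the localisation of the integers at p\<close>

definition local_ints :: "nat \<Rightarrow> 'a::field_char_0 set" where
  "local_ints p = {z. \<exists>m n :: int. n \<noteq> 0 \<and> coprime n (int p) \<and> z = of_int m / of_int n}"

text \<open>Only the difference is constrained; integrality of the two sides is required separately
  where products need it.\<close>

definition local_cong :: "nat \<Rightarrow> nat \<Rightarrow> 'a::field_char_0 \<Rightarrow> 'a \<Rightarrow> bool" where
  "local_cong p s a b \<longleftrightarrow> (\<exists>c\<in>local_ints p. a = b + of_nat p ^ s * c)"

locale odd_prime =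
  fixes p half :: nat
  assumes prime: "prime p" and p_eq: "p = 2 * half + 1"
begin

lemma half_pos: "0 < half"
  using prime p_eq by (cases "half = 0") auto

lemma gt_2: "p > 2" and half_less: "half < p"
  using half_pos p_eq by auto

abbreviation Z :: "'a::field_char_0 set" where "Z \<equiv> local_ints p"
abbreviation cg :: "nat \<Rightarrow> 'a::field_char_0 \<Rightarrow> 'a \<Rightarrow> bool" where "cg \<equiv> local_cong p"

lemma Z_divide_of_int:
  assumes "coprime n (int p)"
  shows "of_int m / of_int n \<in> Z"
proof -
  have "n \<noteq> 0" using assms gt_2 by auto
  with assms show ?thesis by (auto simp: local_ints_def)
qed

lemma Z_of_int [simp, intro]: "of_int m \<in> Z"
  using Z_divide_of_int[of 1 m] by simp

lemma Z_of_nat [simp, intro]: "of_nat m \<in> Z"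
  using Z_of_int[of "int m"] by simp

lemma Z_0 [simp, intro]: "0 \<in> Z" using Z_of_int[of 0] by simp
lemma Z_1 [simp, intro]: "1 \<in> Z" using Z_of_int[of 1] by simp
lemma Z_numeral [simp, intro]: "numeral k \<in> Z" using Z_of_int[of "numeral k"] by simp

lemma Z_add [intro]:
  fixes a b :: "'a::field_char_0"
  assumes "a \<in> Z" "b \<in> Z" shows "a + b \<in> Z"
proof -
  obtain m n m' n' :: int where "n \<noteq> 0" "coprime n (int p)" "a = of_int m / of_int n"
    "n' \<noteq> 0" "coprime n' (int p)" "b = of_int m' / of_int n'"
    using assms by (auto simp: local_ints_def)
  then have "a + b = of_int (m * n' + m' * n) / of_int (n * n')" "coprime (n * n') (int p)"
    by (simp_all add: field_simps)
  then show ?thesis using Z_divide_of_int by metis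
qed

lemma Z_mult [intro]:
  fixes a b :: "'a::field_char_0"
  assumes "a \<in> Z" "b \<in> Z" shows "a * b \<in> Z"
proof -
  obtain m n m' n' :: int where *: "coprime n (int p)" "a = of_int m / of_int n"
    "coprime n' (int p)" "b = of_int m' / of_int n'"
    using assms by (auto simp: local_ints_def)
  then have "a * b = of_int (m * m') / of_int (n * n')" "coprime (n * n') (int p)"
    unfolding * using * by simp_all
  then show ?thesis using Z_divide_of_int by metis
qed

lemma Z_minus [intro]: "a \<in> Z \<Longrightarrow> - a \<in> Z"
  using Z_mult[of "- 1" a] Z_of_int[of "- 1"] by simp

lemma Z_diff [intro]: "a \<in> Z \<Longrightarrow> b \<in> Z \<Longrightarrow> a - b \<in> Z"
  using Z_add[of a "- b"] Z_minus[of b] by simp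

lemma Z_power [intro]: "a \<in> Z \<Longrightarrow> a ^ k \<in> Z"
  by (induction k) auto

lemma Z_sum [intro]: "(\<And>i. i \<in> I \<Longrightarrow> f i \<in> Z) \<Longrightarrow> sum f I \<in> Z"
  by (induction I rule: infinite_finite_induct) auto

lemma Z_prod [intro]: "(\<And>i. i \<in> I \<Longrightarrow> f i \<in> Z) \<Longrightarrow> prod f I \<in> Z"
  by (induction I rule: infinite_finite_induct) auto

lemma Z_divide_of_nat:
  assumes "a \<in> Z" "\<not> p dvd l" shows "a / of_nat l \<in> Z"
proof -
  have "coprime l p"
    using prime_imp_coprime[OF prime assms(2)] by (simp add: coprime_commute)
  then have "1 / of_nat l \<in> Z"
    using Z_divide_of_int[of "int l" 1] by simp
  then show ?thesis
    using Z_mult[OF assms(1), of "1 / of_nat l"] by simp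
qed

lemma not_dvd_less: "0 < l \<Longrightarrow> l < p \<Longrightarrow> \<not> p dvd l"
  by (auto dest: dvd_imp_le)

lemma not_dvd_2: "\<not> p dvd 2"
  using gt_2 by (auto dest: dvd_imp_le)

lemma not_dvd_4: "\<not> p dvd 4"
  using not_dvd_2 prime prime_dvd_mult_iff[of p 2 2] by simp

lemma not_dvd_fact: "k < p \<Longrightarrow> \<not> p dvd fact k"
  using prime by (simp add: prime_dvd_fact_iff)

lemma Z_divide_4: "a \<in> Z \<Longrightarrow> a / 4 \<in> Z"
  using Z_divide_of_nat[OF _ not_dvd_4, of a] by simp

lemma cgI: "c \<in> Z \<Longrightarrow> a = b + of_nat p ^ s * c \<Longrightarrow> cg s a b"
  by (auto simp: local_cong_def)

lemma cgE: assumes "cg s a b" obtains c where "c \<in> Z" "a = b + of_nat p ^ s * c"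
  using assms by (auto simp: local_cong_def)

lemma cg_refl [simp, intro]: "cg s a a"
  by (rule cgI[of 0]) auto

lemma cg_sym: "cg s a b \<Longrightarrow> cg s b a"
  by (erule cgE, rule cgI, erule Z_minus) simp

lemma cg_trans [trans]: "cg s a b \<Longrightarrow> cg s b c \<Longrightarrow> cg s a c"
  by (elim cgE, rule cgI, erule (1) Z_add) (simp add: algebra_simps)

lemma cg_add: "cg s a b \<Longrightarrow> cg s c d \<Longrightarrow> cg s (a + c) (b + d)"
  by (elim cgE, rule cgI, erule (1) Z_add) (simp add: algebra_simps)

lemma cg_minus: "cg s a b \<Longrightarrow> cg s (- a) (- b)"
  by (erule cgE, rule cgI, erule Z_minus) (simp add: algebra_simps)

lemma cg_diff: "cg s a b \<Longrightarrow> cg s c d \<Longrightarrow> cg s (a - c) (b - d)"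
  using cg_add[of s a b "- c" "- d"] cg_minus[of s c d] by simp

lemma cg_scale: "cg s a b \<Longrightarrow> c \<in> Z \<Longrightarrow> cg s (c * a) (c * b)"
  by (elim cgE, rule cgI, erule (1) Z_mult) (simp add: algebra_simps)

lemma cg_mult:
  assumes "cg s a b" "cg s c d" "b \<in> Z" "c \<in> Z"
  shows "cg s (a * c) (b * d)"
  using cg_trans[OF cg_scale[OF assms(1,4)], of "b * d"] cg_scale[OF assms(2,3)]
  by (simp add: mult.commute)

lemma cg_sum: "(\<And>i. i \<in> I \<Longrightarrow> cg s (f i) (g i)) \<Longrightarrow> cg s (sum f I) (sum g I)"
  by (induction I rule: infinite_finite_induct) (auto intro: cg_add)

lemma cg_cancel:
  fixes a b :: "'a::field_char_0"
  assumes "cg s (of_nat l * a) (of_nat l * b)" "\<not> p dvd l"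
  shows "cg s a b"
proof -
  obtain c :: 'a where c: "c \<in> Z" "of_nat l * a = of_nat l * b + of_nat p ^ s * c"
    using assms(1) by (rule cgE)
  have "l \<noteq> 0" using assms(2) by (metis dvd_0_right)
  then have "a = b + of_nat p ^ s * (c / of_nat l)"
    using c(2) by (simp add: field_simps)
  then show ?thesis using Z_divide_of_nat[OF c(1) assms(2)] by (rule cgI[rotated])
qed

lemma cg_power_mult_iff: "cg (t + s) (of_nat p ^ t * a) (of_nat p ^ t * b) \<longleftrightarrow> cg s a b"
proof -
  have "of_nat p ^ t \<noteq> (0 :: 'a)" "p \<noteq> 0" using gt_2 by simp_all
  moreover have "of_nat p ^ t * b + of_nat p ^ (t + s) * c = of_nat p ^ t * (b + of_nat p ^ s * c)" for c :: 'a
    by (simp add: power_add algebra_simps)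
  ultimately show ?thesis unfolding local_cong_def by simp
qed

lemma cg_weaken: assumes "cg s a b" "t \<le> s" shows "cg t a b"
proof -
  obtain c where "c \<in> Z" "a = b + of_nat p ^ s * c" using assms(1) by (rule cgE)
  with assms(2) show ?thesis
    by (intro cgI[of "of_nat p ^ (s - t) * c"]) (auto simp: mult.assoc[symmetric] power_add[symmetric])
qed

lemma Z_divide_fact_square:
  assumes "a \<in> Z" "k < p" shows "a / (fact k)\<^sup>2 \<in> Z"
  using Z_divide_of_nat[OF Z_divide_of_nat[OF assms(1) not_dvd_fact[OF assms(2)]] not_dvd_fact[OF assms(2)]]
  by (simp add: power2_eq_square)

lemma hcoeff_Z: "m \<in> Z \<Longrightarrow> k < p \<Longrightarrow> hcoeff m k \<in> Z"
  unfolding hcoeff_def by (intro Z_divide_fact_square Z_prod Z_diff Z_of_nat)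

lemma hcoeff_deriv_Z: "m \<in> Z \<Longrightarrow> k < p \<Longrightarrow> hcoeff_deriv m k \<in> Z"
  unfolding hcoeff_deriv_def by (intro Z_divide_fact_square Z_sum Z_prod Z_diff Z_of_nat)

lemma binsum_Z:
  assumes "\<And>k. k < p \<Longrightarrow> c k \<in> Z" "x < p" shows "binsum c x \<in> Z"
  unfolding binsum_def using assms(2) by (intro Z_sum Z_mult Z_of_nat assms(1)) simp

text \<open>Induction along the recurrences of \<open>hcoeff\<close> and
  \<open>hcoeff_deriv\<close>. The only division is by squares of indices below \<open>p\<close>, so
  the second-order remainder stays integral.\<close>

lemma hcoeff_taylor:
  fixes m m0 :: "'a::field_char_0"
  assumes "m \<in> Z" "m0 \<in> Z" "k < p"
  shows "\<exists>c\<in>Z. hcoeff m k = hcoeff m0 k + (m - m0) * hcoeff_deriv m0 k + (m - m0)\<^sup>2 * c"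
  using assms(3)
proof (induction k)
  case 0
  then show ?case by (intro bexI[of _ 0]) auto
next
  case (Suc k)
  then obtain c where c: "c \<in> Z"
    "hcoeff m k = hcoeff m0 k + (m - m0) * hcoeff_deriv m0 k + (m - m0)\<^sup>2 * c" by auto
  define d where "d = hcoeff_deriv m0 k + (m - of_nat (k * (k + 1))) * c"
  define K :: 'a where "K = of_nat (Suc k)"
  have K: "K \<noteq> 0" unfolding K_def by (simp del: of_nat_Suc)
  have d: "d \<in> Z" unfolding d_def using hcoeff_deriv_Z[of m0 k] assms Suc.prems c(1)
    by (intro Z_add Z_mult Z_diff Z_of_nat) auto
  have nd: "\<not> p dvd Suc k" using Suc.prems by (intro not_dvd_less) auto
  have "K ^ 2 * hcoeff m (Suc k) = K ^ 2 * hcoeff m0 (Suc k) +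
     (m - m0) * (K ^ 2 * hcoeff_deriv m0 (Suc k)) + (m - m0)\<^sup>2 * d"
    unfolding K_def hcoeff_Suc hcoeff_deriv_Suc d_def c(2)
    by (simp only: power2_eq_square algebra_simps)
  then have "hcoeff m (Suc k) = hcoeff m0 (Suc k) + (m - m0) * hcoeff_deriv m0 (Suc k) +
     (m - m0)\<^sup>2 * (d / K / K)"
    using K by (simp add: field_simps power2_eq_square)
  moreover have "d / K / K \<in> Z"
    unfolding K_def using Z_divide_of_nat[OF Z_divide_of_nat[OF d nd] nd] .
  ultimately show ?case by blast
qed

lemma of_nat_p_eq: "of_nat p = 2 * of_nat half + (1 :: 'a::field_char_0)"
  by (subst p_eq) simp

lemma of_nat_p1: "of_nat (p - 1) = of_nat p - (1 :: 'a::field_char_0)"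
  using gt_2 by (simp add: of_nat_diff)

lemma cg_choose_p: "0 < k \<Longrightarrow> k < p \<Longrightarrow> cg 1 (of_nat (p choose k)) 0"
proof -
  assume k: "0 < k" "k < p"
  have "p dvd (p choose k)"
    using k prime by (intro dvd_choose_prime) auto
  then obtain c where "p choose k = p * c" by blast
  then show ?thesis by (intro cgI[of "of_nat c"]) auto
qed

text \<open>By Pascal's rule neighbouring coefficients of row \<open>p - 1\<close> add up to an
  entry of row \<open>p\<close>, which is a multiple of \<open>p\<close>.\<close>

lemma cg_choose_p1: "k < p \<Longrightarrow> cg 1 (of_nat ((p - 1) choose k)) ((-1) ^ k :: 'a::field_char_0)"
proof (induction k)
  case 0
  then show ?case by simp
next
  case (Suc k)
  have "p choose Suc k = ((p - 1) choose k) + ((p - 1) choose Suc k)"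
    using gt_2 by (subst Suc_pred'[of p]) (auto simp del: Suc_pred)
  then have "of_nat ((p - 1) choose Suc k) = of_nat (p choose Suc k) - (of_nat ((p - 1) choose k) :: 'a)"
    by simp
  moreover have "cg 1 (of_nat (p choose Suc k) - (of_nat ((p - 1) choose k) :: 'a)) (0 - (-1) ^ k)"
    using Suc by (intro cg_diff cg_choose_p) auto
  ultimately show ?case by simp
qed

section \<open>Values modulo powers of p\<close>

definition harm :: "nat \<Rightarrow> 'a::field_char_0" where
  "harm r = (\<Sum>k=1..r. 1 / of_nat k)"

definition altharm2 :: "nat \<Rightarrow> 'a::field_char_0" where
  "altharm2 r = (\<Sum>k=1..r. (-1) ^ k / of_nat k ^ 2)"

lemma inverse_Z: "0 < k \<Longrightarrow> k < p \<Longrightarrow> 1 / of_nat k \<in> Z"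
  by (intro Z_divide_of_nat not_dvd_less) auto

lemma harm_Z: "r < p \<Longrightarrow> harm r \<in> Z"
  unfolding harm_def by (auto intro!: inverse_Z)

lemma altharm2_Z: "r < p \<Longrightarrow> altharm2 r \<in> Z"
  unfolding altharm2_def
proof (intro Z_sum)
  fix k assume "r < p" "k \<in> {1..r}"
  then have "1 / of_nat k \<in> Z" by (intro inverse_Z) auto
  then have "(-1) ^ k * (1 / of_nat k) ^ 2 \<in> Z" by auto
  then show "(-1) ^ k / of_nat k ^ 2 \<in> Z" by (simp add: power_divide)
qed

text \<open>The right-hand side solves, modulo \<open>p^3\<close>, the three-term recurrence in
  \<open>a\<close> at \<open>x = p - 1\<close>, whose middle factor \<open>2 x + 1\<close> is
  \<open>2 p - 1\<close>. The leading coefficient \<open>r^2\<close> is prime to \<open>p\<close>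
  and can be cancelled.\<close>

lemma binsum_pred_p_cong:
  assumes "r < p"
  shows "cg 3 (binsum (hcoeff (of_nat r * (of_nat r + 1))) (p - 1))
     ((-1) ^ r * (1 - 2 * of_nat p * harm r + of_nat p ^ 2 * (2 * harm r ^ 2 + 2 * altharm2 r))
       :: 'a::field_char_0)"
  (is "cg 3 (?s r) (?v r)")
  using assms
proof (induction r rule: less_induct)
  case (less r)
  consider "r = 0" | "r = 1" | q where "r = Suc (Suc q)"
    by (metis One_nat_def not0_implies_Suc)
  then show ?case
  proof cases
    case 1
    then show ?thesis by (simp add: binsum_hcoeff_at_0 harm_def altharm2_def)
  next
    case 2
    \<comment> \<open>At \<open>a = 0\<close> the last term of the recurrence drops out through
      \<open>a^2\<close>. In \<open>?v 1\<close> the quadratic part is zero, as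
      \<open>harm 1 = 1\<close> and \<open>altharm2 1 = - 1\<close>.\<close>
    have "?s 1 = 2 * of_nat p - 1"
      using binsum_param_recurrence[of "0::'a" "p - 1"]
      by (simp add: binsum_hcoeff_at_0 of_nat_p1[unfolded One_nat_def] algebra_simps)
    also have "\<dots> = ?v 1" by (simp add: harm_def altharm2_def)
    finally show ?thesis using 2 by simp
  next
    case (3 q)
    define R :: 'a where "R = of_nat (Suc q)"
    define h :: 'a where "h = harm (Suc q)"
    define e :: 'a where "e = altharm2 (Suc q)"
    define \<sigma> :: 'a where "\<sigma> = (-1) ^ Suc q"
    define u where "u = 1 / R"
    define w where "w = 1 / (R + 1)"
    define P :: 'a where "P = of_nat p"
    have R: "R \<noteq> 0" "R + 1 \<noteq> 0"
      using of_nat_neq_0[of q, where 'a='a] of_nat_neq_0[of "Suc q", where 'a='a]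
      by (simp_all add: R_def add.commute)
    have ru: "R * u = 1" "(R + 1) * w = 1" using R by (simp_all add: u_def w_def)
    have ss: "\<sigma> * \<sigma> = 1" unfolding \<sigma>_def by (simp flip: power_add)
    have 1: "harm q = h - u" "harm (Suc (Suc q)) = h + w" "altharm2 q = e - \<sigma> * u ^ 2"
      "altharm2 (Suc (Suc q)) = e - \<sigma> * w ^ 2" "(-1) ^ q = - \<sigma>" "(-1) ^ Suc (Suc q) = - \<sigma>"
      by (simp_all add: h_def e_def harm_def altharm2_def u_def w_def R_def \<sigma>_def power_divide add.commute)
    have s: "cg 3 (?s q) (?v q)" "cg 3 (?s (Suc q)) (?v (Suc q))"
      by (rule less.IH; use less.prems 3 in simp)+
    have rec: "(R + 1)\<^sup>2 * ?s (Suc (Suc q)) = (2 * R + 1) * (2 * P - 1) * ?s (Suc q) + R\<^sup>2 * ?s q"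
    proof -
      have e: "of_nat q = R - 1" "of_nat (Suc q) = R" "of_nat (Suc (Suc q)) = R + 1"
        "R - 1 + 1 = R" "R + 1 + 1 = R + 2" "2 * of_nat (p - 1) + 1 = 2 * P - 1"
        by (simp_all add: R_def P_def of_nat_p1[unfolded One_nat_def])
      show ?thesis
        unfolding e(1-5) using binsum_param_recurrence[of R "p - 1"] unfolding e(6) .
    qed
    have hZ: "h \<in> Z" "e \<in> Z" using less.prems 3 unfolding h_def e_def by (auto intro!: harm_Z altharm2_Z)
    have "cg 3 ((R + 1)\<^sup>2 * ?s (Suc (Suc q))) ((2 * R + 1) * (2 * P - 1) * ?v (Suc q) + R\<^sup>2 * ?v q)"
      unfolding rec by (intro cg_add cg_scale s) (auto simp: R_def P_def)
    also have "cg 3 \<dots> ((R + 1)\<^sup>2 * ?v (Suc (Suc q)))"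
    proof (rule cgI)
      \<comment> \<open>The recurrence holds exactly up to second order in \<open>P\<close>; the
        leftover is the product of \<open>2 P\<close> with the quadratic part of
        \<open>?v (Suc q)\<close>, times \<open>2 R + 1\<close>.\<close>
      show "(2 * R + 1) * 2 * \<sigma> * (2 * h ^ 2 + 2 * e) \<in> Z"
        unfolding R_def \<sigma>_def using hZ
        by (intro Z_mult Z_add Z_power Z_minus Z_numeral Z_of_nat Z_1)
      show "(2 * R + 1) * (2 * P - 1) * ?v (Suc q) + R\<^sup>2 * ?v q =
         (R + 1)\<^sup>2 * ?v (Suc (Suc q)) + of_nat p ^ 3 * ((2 * R + 1) * 2 * \<sigma> * (2 * h ^ 2 + 2 * e))"
        unfolding 1 P_def[symmetric] h_def[symmetric] e_def[symmetric] \<sigma>_def[symmetric]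
        using ru ss by algebra
    qed
    finally have "cg 3 ((R + 1)\<^sup>2 * ?s (Suc (Suc q))) ((R + 1)\<^sup>2 * ?v (Suc (Suc q)))" .
    moreover have "(R + 1)\<^sup>2 = of_nat ((q + 2) ^ 2)" by (simp add: R_def add.commute)
    ultimately have "cg 3 (of_nat ((q + 2) ^ 2) * ?s (Suc (Suc q))) (of_nat ((q + 2) ^ 2) * ?v (Suc (Suc q)))"
      by (simp only:)
    moreover have "\<not> p dvd (q + 2) ^ 2"
      using less.prems 3 prime_dvd_power[OF prime, of "q + 2" 2] not_dvd_less[of "q + 2"] by auto
    ultimately show ?thesis unfolding 3 by (rule cg_cancel)
  qed
qed

text \<open>Used with \<open>t = p^2 / 4\<close> and \<open>t = - p^2\<close>, where the linear
  coefficient will turn out to be divisible by \<open>p\<close>.\<close>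

lemma prod_shift_expand:
  fixes f :: "'b \<Rightarrow> 'a::field_char_0"
  assumes "finite J" "\<And>i. i \<in> J \<Longrightarrow> f i \<in> Z" "t \<in> Z"
  shows "\<exists>c\<in>Z. (\<Prod>j\<in>J. f j + t) = (\<Prod>j\<in>J. f j) + t * (\<Sum>i\<in>J. \<Prod>j\<in>J - {i}. f j) + t\<^sup>2 * c"
  using assms(1,2)
proof (induction J rule: finite_induct)
  case empty
  show ?case by (intro bexI[of _ 0]) auto
next
  case (insert x J)
  then obtain c where c: "c \<in> Z"
    "(\<Prod>j\<in>J. f j + t) = (\<Prod>j\<in>J. f j) + t * (\<Sum>i\<in>J. \<Prod>j\<in>J - {i}. f j) + t\<^sup>2 * c"
    by auto
  define d where "d = (\<Sum>i\<in>J. \<Prod>j\<in>J - {i}. f j)"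
  have 1: "(\<Sum>i\<in>insert x J. \<Prod>j\<in>insert x J - {i}. f j) = (\<Prod>j\<in>J. f j) + f x * d"
    unfolding d_def using insert.hyps by (rule sum_prod_remove_insert)
  have "(\<Prod>j\<in>insert x J. f j + t) = (\<Prod>j\<in>insert x J. f j) +
     t * (\<Sum>i\<in>insert x J. \<Prod>j\<in>insert x J - {i}. f j) + t\<^sup>2 * (f x * c + t * c + d)"
    unfolding 1 using insert.hyps c(2)[folded d_def]
    by (simp add: algebra_simps power2_eq_square)
  moreover have "f x * c + t * c + d \<in> Z"
    unfolding d_def using insert.prems c(1) assms(3) by (intro Z_add Z_mult Z_sum Z_prod) auto
  ultimately show ?case by blast
qed

section \<open>Sums of inverse squares modulo \<open>p\<close>, and products paired about
  \<open>half\<close>\<close>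

lemma inverse_square_cong:
  assumes "int p dvd (int a)\<^sup>2 - (int b)\<^sup>2" "\<not> p dvd a" "\<not> p dvd b"
  shows "cg 1 (1 / of_nat a ^ 2) (1 / of_nat b ^ 2 :: 'a::field_char_0)"
proof -
  obtain c where c: "(int a)\<^sup>2 - (int b)\<^sup>2 = int p * c" using assms(1) by blast
  have ab: "of_nat a \<noteq> (0::'a)" "of_nat b \<noteq> (0::'a)" using assms(2,3) by (auto intro!: Nat.gr0I)
  have nd: "\<not> p dvd a ^ 2 * b ^ 2" using assms(2,3) prime by (simp add: prime_dvd_mult_iff prime_dvd_power_iff)
  have "1 / of_nat a ^ 2 - 1 / of_nat b ^ 2 =
      - ((of_nat a)\<^sup>2 - (of_nat b)\<^sup>2) / (of_nat a ^ 2 * of_nat b ^ 2 :: 'a)"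
    using ab by (simp add: field_simps)
  also have "(of_nat a)\<^sup>2 - (of_nat b)\<^sup>2 = (of_nat p * of_int c :: 'a)"
    using arg_cong[OF c, of of_int] by simp
  finally have "1 / of_nat a ^ 2 = 1 / of_nat b ^ 2 + of_nat p ^ 1 * (of_int (- c) / of_nat (a ^ 2 * b ^ 2) :: 'a)"
    by (simp add: diff_eq_eq add.commute)
  moreover have "of_int (- c) / of_nat (a ^ 2 * b ^ 2) \<in> Z"
    using nd by (intro Z_divide_of_nat) auto
  ultimately show ?thesis by (rule cgI[rotated])
qed

lemma inverse_square_cong_minus:
  assumes "l < p" "0 < l" shows "cg 1 (1 / of_nat (p - l) ^ 2) (1 / of_nat l ^ 2 :: 'a::field_char_0)"
proof (rule inverse_square_cong)
  have "(int (p - l))\<^sup>2 - (int l)\<^sup>2 = int p * (int p - 2 * int l)"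
    using assms by (simp add: of_nat_diff power2_eq_square algebra_simps)
  then show "int p dvd (int (p - l))\<^sup>2 - (int l)\<^sup>2" by simp
qed (rule not_dvd_less; use assms in simp)+

lemma sum_upto_reflect:
  fixes f :: "nat \<Rightarrow> 'a::comm_monoid_add"
  shows "(\<Sum>j=1..p - 1. f j) = (\<Sum>l=1..half. f l + f (p - l))"
proof -
  have "{1..p - 1} = {1..half} \<union> {half + 1..p - 1}" "{1..half} \<inter> {half + 1..p - 1} = {}"
    using p_eq by auto
  then have "(\<Sum>j=1..p - 1. f j) = (\<Sum>l=1..half. f l) + (\<Sum>j=half + 1..p - 1. f j)"
    by (simp add: sum.union_disjoint)
  also have "(\<Sum>j=half + 1..p - 1. f j) = (\<Sum>l=1..half. f (p - l))"
    by (rule sum.reindex_bij_witness[of _ "\<lambda>l. p - l" "\<lambda>l. p - l"]) (use p_eq in auto)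
  finally show ?thesis by (simp add: sum.distrib)
qed

lemma sum_upto_even_odd:
  fixes f :: "nat \<Rightarrow> 'a::comm_monoid_add"
  shows "(\<Sum>j=1..p - 1. f j) = (\<Sum>l=1..half. f (2 * l) + f (p - 2 * l))"
proof -
  have "{1..p - 1} = {j\<in>{1..p - 1}. even j} \<union> {j\<in>{1..p - 1}. odd j}" by auto
  then have "(\<Sum>j=1..p - 1. f j) = (\<Sum>j\<in>{j\<in>{1..p - 1}. even j}. f j) + (\<Sum>j\<in>{j\<in>{1..p - 1}. odd j}. f j)"
    by (subst (1) \<open>{1..p - 1} = _\<close>, subst sum.union_disjoint) auto
  also have "(\<Sum>j\<in>{j\<in>{1..p - 1}. even j}. f j) = (\<Sum>l=1..half. f (2 * l))"
    by (rule sum.reindex_bij_witness[of _ "\<lambda>l. 2 * l" "\<lambda>j. j div 2"]) (use p_eq in auto)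
  also have "(\<Sum>j\<in>{j\<in>{1..p - 1}. odd j}. f j) = (\<Sum>l=1..half. f (p - 2 * l))"
  proof (rule sum.reindex_bij_witness[of _ "\<lambda>l. p - 2 * l" "\<lambda>j. (p - j) div 2"])
    fix j assume j: "j \<in> {j\<in>{1..p - 1}. odd j}"
    then obtain b where b: "j = 2 * b + 1" by (auto elim!: oddE)
    have d: "(p - j) div 2 = half - b" unfolding b by (subst p_eq) simp
    have h: "b < half" using j b p_eq by simp
    show *: "p - 2 * ((p - j) div 2) = j" unfolding d using b h p_eq by simp
    show "(p - j) div 2 \<in> {1..half}" unfolding d using h by simp
    show "f (p - 2 * ((p - j) div 2)) = f j" unfolding * ..
  next
    fix l assume l: "l \<in> {1..half}"
    show "(p - (p - 2 * l)) div 2 = l" using l p_eq by auto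
    have "odd p" by (subst p_eq) simp
    then show "p - 2 * l \<in> {j\<in>{1..p - 1}. odd j}" using l p_eq by auto
  qed
  finally show ?thesis by (simp add: sum.distrib)
qed

text \<open>The index \<open>half\<close> is the one whose factor \<open>m - j (j + 1)\<close>
  vanishes at \<open>half_param\<close>; the others are paired by their distance from it.\<close>

lemma prod_except_half:
  fixes f :: "nat \<Rightarrow> 'a::comm_monoid_mult"
  shows "(\<Prod>j\<in>{..<p} - {half}. f j) = (\<Prod>l=1..half. f (half - l) * f (half + l))"
proof -
  have *: "{..<p} - {half} = {..<half} \<union> {half<..<p}" using p_eq by auto
  have "(\<Prod>j\<in>{..<p} - {half}. f j) = (\<Prod>j<half. f j) * (\<Prod>j\<in>{half<..<p}. f j)"
    unfolding * by (rule prod.union_disjoint) auto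
  also have "(\<Prod>j<half. f j) = (\<Prod>l=1..half. f (half - l))"
    by (rule prod.reindex_bij_witness[of _ "\<lambda>l. half - l" "\<lambda>l. half - l"]) (use p_eq in auto)
  also have "(\<Prod>j\<in>{half<..<p}. f j) = (\<Prod>l=1..half. f (half + l))"
    by (rule prod.reindex_bij_witness[of _ "\<lambda>l. half + l" "\<lambda>l. l - half"]) (use p_eq in auto)
  finally show ?thesis by (simp add: prod.distrib)
qed

lemma sum_except_half:
  fixes f :: "nat \<Rightarrow> 'a::comm_monoid_add"
  shows "(\<Sum>j\<in>{..<p} - {half}. f j) = (\<Sum>l=1..half. f (half - l) + f (half + l))"
proof -
  have *: "{..<p} - {half} = {..<half} \<union> {half<..<p}" using p_eq by auto
  have "(\<Sum>j\<in>{..<p} - {half}. f j) = (\<Sum>j<half. f j) + (\<Sum>j\<in>{half<..<p}. f j)"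
    unfolding * by (rule sum.union_disjoint) auto
  also have "(\<Sum>j<half. f j) = (\<Sum>l=1..half. f (half - l))"
    by (rule sum.reindex_bij_witness[of _ "\<lambda>l. half - l" "\<lambda>l. half - l"]) (use p_eq in auto)
  also have "(\<Sum>j\<in>{half<..<p}. f j) = (\<Sum>l=1..half. f (half + l))"
    by (rule sum.reindex_bij_witness[of _ "\<lambda>l. half + l" "\<lambda>l. l - half"]) (use p_eq in auto)
  finally show ?thesis by (simp add: sum.distrib)
qed

lemma fact_pred_p: "fact (p - 1) = (\<Prod>l=1..half. of_nat l * (of_nat p - of_nat l) :: 'a::field_char_0)"
proof -
  have "{1..p - 1} = {1..half} \<union> {half + 1..p - 1}" "{1..half} \<inter> {half + 1..p - 1} = {}"
    using p_eq by auto
  then have "fact (p - 1) = (\<Prod>l=1..half. of_nat l :: 'a) * (\<Prod>j=half + 1..p - 1. of_nat j)"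
    unfolding fact_prod of_nat_prod by (simp add: prod.union_disjoint)
  also have "(\<Prod>j=half + 1..p - 1. of_nat j :: 'a) = (\<Prod>l=1..half. of_nat p - of_nat l)"
    by (rule prod.reindex_bij_witness[of _ "\<lambda>l. p - l" "\<lambda>l. p - l"]) (use p_eq in \<open>auto simp: of_nat_diff\<close>)
  finally show ?thesis by (simp add: prod.distrib)
qed

text \<open>The sum over \<open>1, ..., p - 1\<close> is \<open>2 ?H\<close> when \<open>l\<close>
  is paired with \<open>p - l\<close>, and \<open>?H / 2\<close> when \<open>2 l\<close> is paired
  with \<open>p - 2 l\<close>. Hence \<open>3 ?H\<close> vanishes modulo \<open>p\<close>, and
  \<open>p > 3\<close> allows division by \<open>3\<close>.\<close>

lemma sum_inverse_square_half:
  assumes "p > 3"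
  shows "cg 1 (\<Sum>l=1..half. 1 / of_nat l ^ 2) (0 :: 'a::field_char_0)"
proof -
  let ?H = "\<Sum>l=1..half. 1 / of_nat l ^ 2 :: 'a"
  have "cg 1 (\<Sum>j=1..p - 1. 1 / of_nat j ^ 2 :: 'a) (\<Sum>l=1..half. 1 / of_nat l ^ 2 + 1 / of_nat l ^ 2)"
    unfolding sum_upto_reflect
    by (intro cg_sum cg_add cg_refl inverse_square_cong_minus) (use p_eq in auto)
  then have 1: "cg 1 (\<Sum>j=1..p - 1. 1 / of_nat j ^ 2 :: 'a) (2 * ?H)"
    by (simp only: sum.distrib mult_2)
  have "cg 1 (\<Sum>j=1..p - 1. 1 / of_nat j ^ 2 :: 'a)
     (\<Sum>l=1..half. 1 / of_nat (2 * l) ^ 2 + 1 / of_nat (2 * l) ^ 2)"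
    unfolding sum_upto_even_odd
    by (intro cg_sum cg_add cg_refl inverse_square_cong_minus) (use p_eq in auto)
  also have "(\<Sum>l=1..half. 1 / of_nat (2 * l) ^ 2 + 1 / of_nat (2 * l) ^ 2) = ?H / 2"
    by (simp add: power_mult_distrib sum_divide_distrib mult.commute)
  finally have "cg 1 (2 * ?H) (?H / 2)" by (rule cg_trans[OF cg_sym[OF 1]])
  then have "cg 1 (2 * (2 * ?H) - ?H) (2 * (?H / 2) - ?H)"
    by (intro cg_diff cg_scale) auto
  then have "cg 1 (of_nat 3 * ?H) (of_nat 3 * 0)" by simp
  moreover have "\<not> p dvd 3" using assms by (auto dest: dvd_imp_le)
  ultimately show ?thesis by (rule cg_cancel)
qed

lemma sum_inverse_square:
  assumes "p > 3"
  shows "cg 1 (\<Sum>j=1..p - 1. 1 / of_nat j ^ 2) (0 :: 'a::field_char_0)"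
proof -
  have "cg 1 (\<Sum>j=1..p - 1. 1 / of_nat j ^ 2 :: 'a) (\<Sum>l=1..half. 1 / of_nat l ^ 2 + 1 / of_nat l ^ 2)"
    unfolding sum_upto_reflect
    by (intro cg_sum cg_add cg_refl inverse_square_cong_minus) (use p_eq in auto)
  also have "cg 1 \<dots> (0 + 0)"
    unfolding sum.distrib by (intro cg_add sum_inverse_square_half assms)
  finally show ?thesis by simp
qed

text \<open>For \<open>i = half - l\<close> and \<open>i = half + l\<close> the number
  \<open>2 i + 1\<close> is \<open>p - 2 l\<close> and \<open>p + 2 l\<close>, which reduces the
  claim to the previous sums. At \<open>i = half\<close> it would be \<open>p\<close>
  itself.\<close>

lemma sum_inverse_odd_square:
  assumes "p > 3"
  shows "cg 1 (\<Sum>i\<in>{..<p} - {half}. 1 / of_nat (2 * i + 1) ^ 2) (0 :: 'a::field_char_0)"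
proof -
  have 1: "cg 1 (1 / of_nat (2 * (half - l) + 1) ^ 2) (1 / of_nat (2 * l) ^ 2 :: 'a)"
    if "l \<in> {1..half}" for l
  proof -
    have "2 * (half - l) + 1 = p - 2 * l" using that p_eq by auto
    then show ?thesis using inverse_square_cong_minus[of "2 * l"] that p_eq by auto
  qed
  have 2: "cg 1 (1 / of_nat (2 * (half + l) + 1) ^ 2) (1 / of_nat (2 * l) ^ 2 :: 'a)"
    if "l \<in> {1..half}" for l
  proof (rule inverse_square_cong)
    have e: "2 * (half + l) + 1 = p + 2 * l" using p_eq by simp
    show "int p dvd (int (2 * (half + l) + 1))\<^sup>2 - (int (2 * l))\<^sup>2"
      unfolding e by (simp add: power2_eq_square algebra_simps)
    show nd: "\<not> p dvd 2 * l" using that p_eq by (intro not_dvd_less) auto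
    show "\<not> p dvd 2 * (half + l) + 1" unfolding e using nd by (simp add: dvd_add_right_iff)
  qed
  have "cg 1 (\<Sum>i\<in>{..<p} - {half}. 1 / of_nat (2 * i + 1) ^ 2 :: 'a)
     (\<Sum>l=1..half. 1 / of_nat (2 * l) ^ 2 + 1 / of_nat (2 * l) ^ 2)"
    unfolding sum_except_half by (intro cg_sum cg_add 1 2)
  also have "(\<Sum>l=1..half. 1 / of_nat (2 * l) ^ 2 + 1 / of_nat (2 * l) ^ 2) =
     (1 / of_nat 2) * (\<Sum>l=1..half. 1 / of_nat l ^ 2 :: 'a)"
    by (simp add: power_mult_distrib sum_divide_distrib mult.commute)
  also have "cg 1 \<dots> ((1 / of_nat 2) * 0)"
    by (intro cg_scale sum_inverse_square_half assms Z_divide_of_nat not_dvd_2) auto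
  finally show ?thesis by simp
qed

text \<open>Each factor is \<open>(1 + x) / (1 - x)\<close> with \<open>x = p / l\<close>, whose
  logarithm is \<open>2 x\<close> up to third order; the product is thus
  \<open>exp (2 p harm r)\<close> to second order in \<open>p\<close>.\<close>

lemma prod_ratio_cong:
  assumes "r < p"
  shows "cg 3 (\<Prod>l=1..r. (of_nat l + of_nat p) / (of_nat l - of_nat p))
    (1 + 2 * of_nat p * harm r + 2 * of_nat p ^ 2 * harm r ^ 2 :: 'a::field_char_0)"
  (is "cg 3 (?U r) (?v r)")
  using assms
proof (induction r)
  case 0
  then show ?case by (simp add: harm_def)
next
  case (Suc r)
  define P :: 'a where "P = of_nat p"
  define L :: 'a where "L = of_nat (Suc r)"
  define h :: 'a where "h = harm r"
  define u where "u = 1 / L"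
  have "L \<noteq> 0" unfolding L_def by (simp del: of_nat_Suc)
  then have Lu: "L * u = 1" by (simp add: u_def)
  have pl: "of_nat (p - Suc r) = P - L"
    using Suc.prems by (simp add: P_def L_def of_nat_diff)
  have "P - L \<noteq> 0" unfolding pl[symmetric] of_nat_eq_0_iff using Suc.prems by simp
  then have "L - P \<noteq> 0" by auto
  have h: "h \<in> Z" "h + u \<in> Z" "harm (Suc r) = h + u"
    using Suc.prems harm_Z[of "Suc r"] harm_Z[of r] by (auto simp: h_def u_def L_def harm_def)
  have "of_nat (p - Suc r) * ?U (Suc r) = - (L + P) * ?U r"
  proof -
    have "?U (Suc r) = ?U r * ((L + P) / (L - P))" by (simp add: L_def P_def)
    moreover have "(P - L) * (y * ((L + P) / (L - P))) = - (L + P) * y" for y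
      using \<open>L - P \<noteq> 0\<close> by (simp add: field_simps)
    ultimately show ?thesis unfolding pl by simp
  qed
  also have "cg 3 \<dots> (- (L + P) * ?v r)"
    using Suc by (intro cg_scale) (auto simp: L_def P_def)
  also have "cg 3 \<dots> (of_nat (p - Suc r) * ?v (Suc r))"
  proof (rule cgI)
    show "- 2 * h ^ 2 - 2 * (h + u) ^ 2 \<in> Z"
      using h by (intro Z_diff Z_mult Z_minus Z_power Z_numeral)
    show "- (L + P) * ?v r = of_nat (p - Suc r) * ?v (Suc r) +
        of_nat p ^ 3 * (- 2 * h ^ 2 - 2 * (h + u) ^ 2)"
      unfolding h(3) pl h_def[symmetric] P_def[symmetric] using Lu by algebra
  qed
  finally show ?case
  proof (rule cg_cancel)
    show "\<not> p dvd p - Suc r" using Suc.prems by (intro not_dvd_less) auto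
  qed
qed

section \<open>The coefficient of index \<open>p\<close> and its derivative\<close>

text \<open>The factor \<open>p^2\<close> clears the only powers of \<open>p\<close> in the
  denominator. The factor of index \<open>half\<close> is split off because it is \<open>0\<close>
  at \<open>half_param\<close> and \<open>- p^2 / 4\<close> at \<open>- 1 / 4\<close>.\<close>

lemma hcoeff_deriv_p:
  "of_nat p ^ 2 * hcoeff_deriv m p =
     ((\<Prod>j\<in>{..<p} - {half}. m - of_nat (j * (j + 1))) + (m - of_nat (half * (half + 1))) *
      (\<Sum>i\<in>{..<p} - {half}. \<Prod>j\<in>{..<p} - {half} - {i}. m - of_nat (j * (j + 1)))) /
      (fact (p - 1))\<^sup>2"
proof -
  have *: "insert half ({..<p} - {half}) = {..<p}" using half_less by auto
  have "fact p = of_nat p * (fact (p - 1) :: 'a)" "of_nat p \<noteq> (0 :: 'a)"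
    using gt_2 by (auto simp: fact_reduce)
  then show ?thesis
    unfolding hcoeff_deriv_def
    by (subst sum_prod_remove_insert[of "{..<p} - {half}" half "\<lambda>j. m - of_nat (j * (j + 1))", unfolded *])
       (simp_all add: power_mult_distrib)
qed

lemma hcoeff_p:
  "hcoeff m p = (m - of_nat (half * (half + 1))) / of_nat p ^ 2 *
     (\<Prod>j\<in>{..<p} - {half}. m - of_nat (j * (j + 1))) / (fact (p - 1))\<^sup>2"
proof -
  have "fact p = of_nat p * (fact (p - 1) :: 'a)" "of_nat p \<noteq> (0 :: 'a)"
    using gt_2 by (auto simp: fact_reduce)
  moreover have "(\<Prod>j<p. m - of_nat (j * (j + 1))) = (m - of_nat (half * (half + 1))) *
      (\<Prod>j\<in>{..<p} - {half}. m - of_nat (j * (j + 1)))"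
    using half_less by (subst prod.remove[of _ half]) auto
  ultimately show ?thesis
    unfolding hcoeff_def by (simp add: power_mult_distrib)
qed

abbreviation half_param :: "'a::field_char_0" where
  "half_param \<equiv> of_nat half * (of_nat half + 1)"

lemma half_param_Z: "half_param \<in> Z" by auto

lemma half_param_eq: "half_param = - 1 / 4 + of_nat p ^ 2 / (4 :: 'a::field_char_0)"
  unfolding of_nat_p_eq by (simp add: field_simps power2_eq_square)

lemma half_param_diff: "half_param - of_nat (half * (half + 1)) = 0"
  by (simp add: algebra_simps)

lemma hcoeff_half_param_p: "hcoeff half_param p = 0"
  unfolding hcoeff_p half_param_diff by simp

text \<open>Only the product without the factor of index \<open>half\<close> survives. Its factors
  at \<open>half - l\<close> and \<open>half + l\<close> are \<open>l (p - l)\<close> and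
  \<open>- l (p + l)\<close>; divided by \<open>(l (p - l))^2\<close> they give the ratios of
  \<open>prod_ratio_cong\<close>.\<close>

lemma hcoeff_deriv_half_param_p:
  "cg 3 (of_nat p ^ 2 * hcoeff_deriv half_param p)
    (1 + 2 * of_nat p * harm half + 2 * of_nat p ^ 2 * harm half ^ 2 :: 'a::field_char_0)"
proof -
  let ?f = "\<lambda>j. half_param - of_nat (j * (j + 1)) :: 'a"
  have "of_nat p ^ 2 * hcoeff_deriv half_param p = (\<Prod>j\<in>{..<p} - {half}. ?f j) / (fact (p - 1))\<^sup>2"
    unfolding hcoeff_deriv_p half_param_diff by simp
  also have "\<dots> = (\<Prod>l=1..half. ?f (half - l) * ?f (half + l)) /
      (\<Prod>l=1..half. of_nat l * (of_nat p - of_nat l))\<^sup>2"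
    unfolding prod_except_half fact_pred_p ..
  also have "\<dots> = (\<Prod>l=1..half. (?f (half - l) * ?f (half + l)) / (of_nat l * (of_nat p - of_nat l))\<^sup>2)"
    by (simp add: prod_dividef prod_power_distrib)
  also have "\<dots> = (\<Prod>l=1..half. (of_nat l + of_nat p) / (of_nat l - of_nat p))"
  proof (rule prod.cong[OF refl])
    fix l assume l: "l \<in> {1..half}"
    define P H L :: 'a where "P = of_nat p" and "H = of_nat half" and "L = of_nat l"
    have P: "P = 2 * H + 1" unfolding P_def H_def by (rule of_nat_p_eq)
    have 1: "?f (half - l) = L * (P - L)" and 2: "?f (half + l) = - L * (P + L)"
      using l unfolding P
      by (simp_all only: of_nat_mult of_nat_add of_nat_1 of_nat_diff atLeastAtMost_iff
           H_def[symmetric] L_def[symmetric]) (simp_all add: algebra_simps)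
    have "L \<noteq> 0" using l by (simp add: L_def)
    moreover have "P - L \<noteq> 0" unfolding P_def L_def using l half_less by simp
    moreover have "L - P \<noteq> 0" using calculation by auto
    ultimately show "(?f (half - l) * ?f (half + l)) / (of_nat l * (of_nat p - of_nat l))\<^sup>2 =
        (of_nat l + of_nat p) / (of_nat l - of_nat p)"
      unfolding 1 2 P_def[symmetric] L_def[symmetric]
      by (simp add: divide_simps power2_eq_square) (simp add: algebra_simps)
  qed
  also have "cg 3 \<dots> (1 + 2 * of_nat p * harm half + 2 * of_nat p ^ 2 * harm half ^ 2)"
    by (rule prod_ratio_cong) (rule half_less)
  finally show ?thesis .
qed

lemma hcoeff_deriv_half_param_p_mod_p:
  "cg 1 (of_nat p ^ 2 * hcoeff_deriv half_param p) (1 :: 'a::field_char_0)"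
proof -
  have "cg 1 (of_nat p ^ 2 * hcoeff_deriv half_param p)
      (1 + 2 * of_nat p * harm half + 2 * of_nat p ^ 2 * harm half ^ 2 :: 'a)"
    using hcoeff_deriv_half_param_p by (rule cg_weaken) simp
  also have "cg 1 \<dots> 1"
  proof (rule cgI)
    show "2 * harm half + 2 * of_nat p * harm half ^ 2 \<in> Z"
      by (intro Z_add Z_mult Z_power Z_numeral Z_of_nat harm_Z half_less)
  qed (simp add: power2_eq_square algebra_simps)
  finally show ?thesis .
qed

lemma minus_quarter_Z: "- 1 / 4 \<in> Z"
  by (intro Z_divide_4) auto

text \<open>The two parameters differ by \<open>t = p^2 / 4\<close>. The linear coefficient
  \<open>Q\<close> of the product over \<open>J\<close> is that product times a multiple of the sum
  of inverse odd squares, so \<open>p\<close> divides \<open>Q\<close>.\<close>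

lemma hcoeff_deriv_minus_quarter_p:
  assumes "p > 3"
  shows "cg 3 (of_nat p ^ 2 * hcoeff_deriv (- 1 / 4) p)
    (of_nat p ^ 2 * hcoeff_deriv half_param p :: 'a::field_char_0)" (is ?thesis1)
  and "cg 1 (hcoeff (- 1 / 4) p) (- 1 / 4 :: 'a)" (is ?thesis2)
proof -
  define J where "J = {..<p} - {half}"
  define f where "f j = - 1 / 4 - (of_nat (j * (j + 1)) :: 'a)" for j
  define t :: 'a where "t = of_nat p ^ 2 / 4"
  define Q where "Q = (\<Sum>i\<in>J. \<Prod>j\<in>J - {i}. f j)"
  define F :: 'a where "F = (fact (p - 1))\<^sup>2"
  have F: "F \<noteq> 0" by (simp add: F_def)
  have divF: "c / F \<in> Z" if "c \<in> Z" for c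
    unfolding F_def using that gt_2 by (intro Z_divide_fact_square) auto
  have J: "finite J" by (simp add: J_def)
  have fZ: "f j \<in> Z" for j unfolding f_def by (intro Z_diff minus_quarter_Z Z_of_nat)
  have tZ: "t \<in> Z" unfolding t_def by (intro Z_divide_4) auto
  have f_eq: "f j = - (of_nat (2 * j + 1) ^ 2) / 4" for j
    by (simp add: f_def field_simps power2_eq_square)
  have f0: "f j \<noteq> 0" for j
  proof -
    have "of_nat (2 * j + 1) \<noteq> (0 :: 'a)" unfolding of_nat_eq_0_iff by simp
    then show ?thesis unfolding f_eq by (simp del: of_nat_add of_nat_mult)
  qed
  have t_eq: "- 1 / 4 - of_nat (half * (half + 1)) = - t"
    using half_param_eq[where 'a='a] by (simp add: t_def algebra_simps)
  have "Q = (\<Prod>j\<in>J. f j) * (\<Sum>i\<in>J. 1 / f i)"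
    unfolding Q_def using J f0 by (rule sum_prod_remove)
  also have "(\<Sum>i\<in>J. 1 / f i) = - 4 * (\<Sum>i\<in>J. 1 / of_nat (2 * i + 1) ^ 2)"
    unfolding f_eq sum_distrib_left by (intro sum.cong) auto
  also have "cg 1 ((\<Prod>j\<in>J. f j) * (- 4 * (\<Sum>i\<in>J. 1 / of_nat (2 * i + 1) ^ 2))) ((\<Prod>j\<in>J. f j) * (- 4 * 0))"
    unfolding J_def using fZ by (intro cg_scale sum_inverse_odd_square assms Z_prod) auto
  finally obtain q where q: "q \<in> Z" "Q = of_nat p * q" by (auto elim!: cgE)
  obtain c where c: "c \<in> Z" "(\<Prod>j\<in>J. f j + t) = (\<Prod>j\<in>J. f j) + t * Q + t\<^sup>2 * c"
    using prod_shift_expand[of J f t] J fZ tZ unfolding Q_def by auto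
  have B1: "of_nat p ^ 2 * hcoeff_deriv (- 1 / 4) p = ((\<Prod>j\<in>J. f j) + - t * Q) / F"
    unfolding hcoeff_deriv_p t_eq unfolding f_def[symmetric] J_def[symmetric] Q_def[symmetric] F_def ..
  have "half_param - of_nat (j * (j + 1)) = f j + t" for j
    unfolding half_param_eq by (simp add: f_def t_def)
  then have B0: "of_nat p ^ 2 * hcoeff_deriv half_param p = (\<Prod>j\<in>J. f j + t) / F"
    unfolding hcoeff_deriv_p half_param_diff by (simp add: J_def F_def)
  \<comment> \<open>The linear terms have opposite signs and do not cancel: the difference contains
    \<open>- 2 t Q\<close>, a multiple of \<open>p^3\<close> because \<open>p\<close> divides
    \<open>Q\<close>.\<close>
  show ?thesis1
  proof (rule cgI)
    show "- (2 * q / 4 + of_nat p * c / 4 / 4) / F \<in> Z"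
      using q(1) c(1) by (intro divF Z_minus Z_add Z_divide_4 Z_mult) auto
    show "of_nat p ^ 2 * hcoeff_deriv (- 1 / 4) p = of_nat p ^ 2 * hcoeff_deriv half_param p +
        of_nat p ^ 3 * (- (2 * q / 4 + of_nat p * c / 4 / 4) / F)"
      unfolding B1 B0 c(2) unfolding q(2) t_def using F
      by (simp add: field_simps power2_eq_square power3_eq_cube)
  qed
  define U :: 'a where "U = of_nat p ^ 2 * hcoeff_deriv half_param p"
  have "cg 1 U 1" unfolding U_def by (rule hcoeff_deriv_half_param_p_mod_p)
  moreover have "cg 1 ((\<Prod>j\<in>J. f j) / F) U"
  proof (rule cgI)
    show "- (of_nat p * (Q / 4) + of_nat p ^ 3 * (c / 4 / 4)) / F \<in> Z"
      using q c(1) by (intro divF Z_minus Z_add Z_divide_4 Z_mult) auto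
    show "(\<Prod>j\<in>J. f j) / F = U + of_nat p ^ 1 * (- (of_nat p * (Q / 4) + of_nat p ^ 3 * (c / 4 / 4)) / F)"
      unfolding U_def B0 c(2) unfolding t_def using F
      by (simp add: field_simps power2_eq_square power3_eq_cube)
  qed
  ultimately have "cg 1 ((\<Prod>j\<in>J. f j) / F) 1" by (rule cg_trans[rotated])
  then have "cg 1 ((- 1 / 4) * ((\<Prod>j\<in>J. f j) / F)) ((- 1 / 4) * 1)"
    by (intro cg_scale minus_quarter_Z)
  moreover have "hcoeff (- 1 / 4) p = (- 1 / 4) * ((\<Prod>j\<in>J. f j) / F)"
    unfolding hcoeff_p t_eq unfolding f_def[symmetric] J_def[symmetric] F_def[symmetric]
    using gt_2 by (simp add: t_def)
  ultimately show ?thesis2 by simp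
qed

section \<open>Alternating sums at \<open>p + r\<close> modulo \<open>p^3\<close>\<close>

text \<open>To first order in \<open>p^2\<close> the product is \<open>1\<close> minus
  \<open>p^2\<close> times the sum of the inverse squares, and that sum is divisible by
  \<open>p\<close>.\<close>

lemma sqprod_p:
  assumes "p > 3"
  shows "cg 3 (sqprod (p - 1) (of_nat p)) (1 :: 'a::field_char_0)"
proof -
  define J where "J = {1..p - 1}"
  define f where "f j = (of_nat j ^ 2 :: 'a)" for j
  define t :: 'a where "t = - (of_nat p ^ 2)"
  define F :: 'a where "F = (fact (p - 1))\<^sup>2"
  have F: "F \<noteq> 0" by (simp add: F_def)
  have divF: "c / F \<in> Z" if "c \<in> Z" for c
    unfolding F_def using that gt_2 by (intro Z_divide_fact_square) auto
  have fF: "(\<Prod>j\<in>J. f j) = F"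
    by (simp add: f_def F_def J_def fact_prod prod_power_distrib)
  obtain c where c: "c \<in> Z" "(\<Prod>j\<in>J. f j + t) = F + t * (\<Sum>i\<in>J. \<Prod>j\<in>J - {i}. f j) + t\<^sup>2 * c"
    using prod_shift_expand[of J f t] unfolding fF by (auto simp: J_def f_def t_def)
  obtain s where s: "s \<in> Z" "(\<Sum>j\<in>J. 1 / f j) = of_nat p * s"
    using sum_inverse_square[OF assms, where 'a='a] by (auto simp: J_def f_def elim!: cgE)
  have Q: "(\<Sum>i\<in>J. \<Prod>j\<in>J - {i}. f j) = F * (of_nat p * s)"
    unfolding fF[symmetric] s(2)[symmetric] by (rule sum_prod_remove) (auto simp: J_def f_def)
  have "sqprod (p - 1) (of_nat p) = (\<Prod>j\<in>J. f j + t) / F"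
    by (simp add: sqprod_def J_def f_def t_def F_def)
  also have "\<dots> = 1 + of_nat p ^ 3 * (of_nat p * (c / F) - s)"
    unfolding c(2) unfolding Q t_def using F
    by (simp add: field_simps power2_eq_square power3_eq_cube)
  finally have "sqprod (p - 1) (of_nat p) = 1 + of_nat p ^ 3 * (of_nat p * (c / F) - s)" .
  moreover have "of_nat p * (c / F) - s \<in> Z"
    using divF[OF c(1)] s(1) by (intro Z_diff Z_mult Z_of_nat)
  ultimately show ?thesis by (rule cgI[rotated])
qed

text \<open>With \<open>K = p - 1\<close>, the step of \<open>sqprod_shift\<close> from
  \<open>p\<close> to \<open>p + 1\<close> supplies the factor \<open>2 p^2\<close>. Later steps
  multiply by \<open>(p + r) (2 p + r) / ((p + r + 1) (r + 1))\<close>, which matters only modulo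
  \<open>p\<close>, where it is \<open>r^2 / (r + 1)^2\<close>.\<close>

lemma sqprod_p_add:
  assumes "p > 3" "Suc r < p"
  shows "cg 3 (sqprod (p - 1) (of_nat p + of_nat (Suc r)))
     (2 * of_nat p ^ 2 / of_nat (Suc r) ^ 2 :: 'a::field_char_0)"
  using assms(2)
proof (induction r)
  case 0
  define P :: 'a where "P = of_nat p"
  have "of_nat (p + 1) * sqprod (p - 1) (P + 1) = 2 * P ^ 2 * sqprod (p - 1) P"
    using sqprod_shift[of P "p - 1"] by (simp add: P_def of_nat_p1[unfolded One_nat_def] algebra_simps power2_eq_square)
  also have "cg 3 \<dots> (2 * P ^ 2 * 1)"
    unfolding P_def by (intro cg_scale sqprod_p assms) auto
  also have "cg 3 \<dots> (of_nat (p + 1) * (2 * P ^ 2))"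
    by (rule cgI[of "- 2"]) (auto simp: P_def power2_eq_square power3_eq_cube algebra_simps intro!: Z_minus)
  finally have "cg 3 (sqprod (p - 1) (P + 1)) (2 * P ^ 2)"
  proof (rule cg_cancel)
    show "\<not> p dvd p + 1" using gt_2 dvd_add_right_iff[of p p 1] by auto
  qed
  then show ?case by (simp add: P_def)
next
  case (Suc r)
  define P R :: 'a where "P = of_nat p" and "R = of_nat (Suc r)"
  define u w where "u = 1 / R" and "w = 1 / (R + 1)"
  have w_def': "w = 1 / of_nat (Suc (Suc r))" by (simp add: w_def R_def add.commute)
  have "R \<noteq> 0" "R + 1 \<noteq> 0"
    using of_nat_neq_0[of r, where 'a='a] of_nat_neq_0[of "Suc r", where 'a='a]
    by (simp_all add: R_def add.commute)
  then have uw: "R * u = 1" "(R + 1) * w = 1" by (simp_all add: u_def w_def)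
  have uwZ: "u \<in> Z" "w \<in> Z"
    using Suc.prems inverse_Z[of "Suc r"] inverse_Z[of "Suc (Suc r)"]
    by (auto simp: u_def R_def w_def' simp del: of_nat_Suc)
  have RZ: "R \<in> Z" "P \<in> Z" by (auto simp: R_def P_def)
  have "of_nat ((p + Suc (Suc r)) * Suc (Suc r)) * sqprod (p - 1) (P + of_nat (Suc (Suc r))) =
     (2 * P + R) * (P + R) * sqprod (p - 1) (P + R)"
    using sqprod_shift[of "P + R" "p - 1"]
    by (simp add: P_def R_def of_nat_p1[unfolded One_nat_def] algebra_simps)
  also have "cg 3 \<dots> ((2 * P + R) * (P + R) * (2 * P ^ 2 * u ^ 2))"
    using Suc RZ by (intro cg_scale) (auto simp: P_def R_def u_def power_divide)
  also have "cg 3 \<dots> (of_nat ((p + Suc (Suc r)) * Suc (Suc r)) * (2 * P ^ 2 * w ^ 2))"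
  proof (rule cgI)
    show "(4 * P + 6 * R) * u ^ 2 - 2 * (R + 1) * w ^ 2 \<in> Z"
      using RZ uwZ by (intro Z_diff Z_add Z_mult Z_power Z_numeral Z_1)
    have e: "of_nat ((p + Suc (Suc r)) * Suc (Suc r)) = (P + R + 1) * (R + 1)"
      by (simp add: P_def R_def algebra_simps)
    show "(2 * P + R) * (P + R) * (2 * P ^ 2 * u ^ 2) =
        of_nat ((p + Suc (Suc r)) * Suc (Suc r)) * (2 * P ^ 2 * w ^ 2) +
        of_nat p ^ 3 * ((4 * P + 6 * R) * u ^ 2 - 2 * (R + 1) * w ^ 2)"
      unfolding e P_def[symmetric] using uw by algebra
  qed
  finally have "cg 3 (sqprod (p - 1) (P + of_nat (Suc (Suc r)))) (2 * P ^ 2 * w ^ 2)"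
  proof (rule cg_cancel)
    show "\<not> p dvd (p + Suc (Suc r)) * Suc (Suc r)"
      using Suc.prems prime not_dvd_less[of "Suc (Suc r)"]
      by (metis dvd_refl dvd_add_right_iff prime_dvd_mult_iff gr0_conv_Suc)
  qed
  then show ?case by (simp add: P_def w_def' power_divide)
qed

text \<open>\<open>altsum_recurrence\<close> is iterated from the exact value \<open>1\<close> at
  \<open>p - 1\<close>; \<open>sqprod_p\<close> gives the step to \<open>p\<close>, and
  \<open>sqprod_p_add\<close> each later correction.\<close>

lemma altsum_p_add:
  assumes "p > 3" "r < p"
  shows "cg 3 (altsum (p - 1) (of_nat p + of_nat r))
     ((-1) ^ r * (1 + 4 * of_nat p ^ 2 * altharm2 r) :: 'a::field_char_0)"
  using assms(2)
proof (induction r)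
  case 0
  have "altsum (p - 1) (of_nat p - 1 :: 'a) = 1"
  proof -
    have "even (p - 1)" by (subst p_eq) simp
    then show ?thesis
      using altsum_of_nat[of "p - 1" "p - 1", where 'a='a] by (simp add: of_nat_p1[unfolded One_nat_def])
  qed
  then have "altsum (p - 1) (of_nat p) = 2 * sqprod (p - 1) (of_nat p) - (1::'a)"
    using altsum_recurrence[of "p - 1" "of_nat p :: 'a"] by (simp add: algebra_simps)
  also have "cg 3 \<dots> (2 * 1 - 1)"
    by (intro cg_diff cg_scale sqprod_p assms) auto
  finally show ?case by (simp add: altharm2_def)
next
  case (Suc r)
  have "altsum (p - 1) (of_nat p + of_nat (Suc r)) =
     2 * sqprod (p - 1) (of_nat p + of_nat (Suc r)) - altsum (p - 1) (of_nat p + of_nat r :: 'a)"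
    using altsum_recurrence[of "p - 1" "of_nat p + of_nat (Suc r) :: 'a"] by (simp add: algebra_simps)
  also have "cg 3 \<dots> (2 * (2 * of_nat p ^ 2 / of_nat (Suc r) ^ 2) -
      (-1) ^ r * (1 + 4 * of_nat p ^ 2 * altharm2 r))"
    using Suc by (intro cg_diff cg_scale sqprod_p_add assms) auto
  also have "2 * (2 * of_nat p ^ 2 / of_nat (Suc r) ^ 2) - (-1) ^ r * (1 + 4 * of_nat p ^ 2 * altharm2 r) =
     (-1) ^ Suc r * (1 + 4 * of_nat p ^ 2 * altharm2 (Suc r) :: 'a)"
  proof -
    define e x y :: 'a where "e = (-1) ^ r" and "x = 1 / of_nat (Suc r) ^ 2" and "y = altharm2 r"
    have ee: "e * e = 1" unfolding e_def by (simp flip: power_add)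
    have 1: "altharm2 (Suc r) = y - e * x" by (simp add: altharm2_def e_def x_def y_def)
    have 2: "2 * (2 * of_nat p ^ 2 / of_nat (Suc r) ^ 2) = 4 * of_nat p ^ 2 * x" by (simp add: x_def)
    show ?thesis
      unfolding 1 2 power_Suc unfolding e_def[symmetric] y_def[symmetric] using ee by algebra
  qed
  finally show ?case .
qed

section \<open>First-order expansion in \<open>m\<close>, and the derivative of \<open>S\<close> at
  \<open>p - 1\<close>\<close>

text \<open>The weights \<open>w\<close> are signs in the application to \<open>altsum\<close> and
  binomial coefficients in that to \<open>binsum\<close>.\<close>

lemma sum_hcoeff_taylor:
  fixes m m0 :: "'a::field_char_0"
  assumes "m \<in> Z" "m0 \<in> Z" "\<And>k. w k \<in> Z"
  shows "\<exists>c\<in>Z. (\<Sum>k<p. hcoeff m k * w k) =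
    (\<Sum>k<p. hcoeff m0 k * w k) + (m - m0) * (\<Sum>k<p. hcoeff_deriv m0 k * w k) + (m - m0)\<^sup>2 * c"
proof -
  obtain c where c: "\<And>k. k < p \<Longrightarrow> c k \<in> Z \<and>
      hcoeff m k = hcoeff m0 k + (m - m0) * hcoeff_deriv m0 k + (m - m0)\<^sup>2 * c k"
    using hcoeff_taylor[OF assms(1,2)] by metis
  have "(\<Sum>k<p. hcoeff m k * w k) =
    (\<Sum>k<p. (hcoeff m0 k + (m - m0) * hcoeff_deriv m0 k + (m - m0)\<^sup>2 * c k) * w k)"
    using c by (intro sum.cong) auto
  also have "\<dots> = (\<Sum>k<p. hcoeff m0 k * w k) +
      (m - m0) * (\<Sum>k<p. hcoeff_deriv m0 k * w k) + (m - m0)\<^sup>2 * (\<Sum>k<p. c k * w k)"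
    unfolding sum_distrib_left sum.distrib[symmetric]
    by (intro sum.cong) (simp_all add: algebra_simps)
  finally have "(\<Sum>k<p. hcoeff m k * w k) = (\<Sum>k<p. hcoeff m0 k * w k) +
      (m - m0) * (\<Sum>k<p. hcoeff_deriv m0 k * w k) + (m - m0)\<^sup>2 * (\<Sum>k<p. c k * w k)" .
  moreover have "(\<Sum>k<p. c k * w k) \<in> Z"
    using c assms(3) by (intro Z_sum Z_mult) auto
  ultimately show ?thesis by auto
qed

lemma binsum_hcoeff_Z: "m \<in> Z \<Longrightarrow> x < p \<Longrightarrow> binsum (hcoeff m) x \<in> Z"
  by (rule binsum_Z[OF hcoeff_Z])

lemma binsum_hcoeff_deriv_Z: "m \<in> Z \<Longrightarrow> x < p \<Longrightarrow> binsum (hcoeff_deriv m) x \<in> Z"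
  by (rule binsum_Z[OF hcoeff_deriv_Z])

lemma pred_p_less: "p - 1 < p"
  using gt_2 by simp

lemma atMost_pred_p: "{..p - 1} = {..<p}"
  using gt_2 by auto

lemma binsum_pred_p: "binsum c (p - 1) = (\<Sum>k<p. c k * of_nat ((p - 1) choose k))"
  unfolding binsum_def atMost_pred_p ..

lemma binsum_p: "binsum c p = (\<Sum>k<p. c k * of_nat (p choose k)) + c p"
proof -
  have "{..p} = insert p {..<p}" by auto
  then show ?thesis by (simp add: binsum_def add.commute)
qed

text \<open>
  Replacing \<open>a = half\<close> by \<open>half + p\<close> changes \<open>a (a + 1)\<close> by exactly \<open>2 p\<^sup>2\<close>, so the values of
  \<^const>\<open>altsum\<close> modulo \<open>p\<^sup>3\<close> determine its derivative modulo \<open>p\<close>.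
\<close>

lemma altsum_hcoeff_deriv:
  assumes "p > 3"
  shows "cg 1 (\<Sum>k<p. hcoeff_deriv half_param k * (-1) ^ k) (2 * (-1) ^ half * altharm2 half :: 'a::field_char_0)"
proof -
  define P H :: 'a where "P = of_nat p" and "H = of_nat half"
  define G :: 'a where "G = (\<Sum>k<p. hcoeff_deriv half_param k * (-1) ^ k)"
  have P: "P = 2 * H + 1" unfolding P_def H_def by (rule of_nat_p_eq)
  have as: "altsum (p - 1) a = (\<Sum>k<p. hcoeff (a * (a + 1)) k * (-1) ^ k)" for a :: 'a
    unfolding altsum_def atMost_pred_p by (simp add: mult.commute)
  have asH: "altsum (p - 1) H = (\<Sum>k<p. hcoeff half_param k * (-1) ^ k)"
    unfolding as H_def ..
  have HZ: "half_param \<in> Z" "(P + H) * (P + H + 1) \<in> Z"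
    unfolding P_def H_def by (intro Z_add Z_mult Z_of_nat Z_1)+
  have d: "(P + H) * (P + H + 1) - half_param = 2 * P ^ 2"
    unfolding P H_def by algebra
  obtain c where c: "c \<in> Z" "altsum (p - 1) (P + H) = altsum (p - 1) H + 2 * P ^ 2 * G + (2 * P ^ 2)\<^sup>2 * c"
    using sum_hcoeff_taylor[OF HZ(2,1), of "\<lambda>k. (-1) ^ k", OF Z_power[OF Z_minus[OF Z_1]]]
    unfolding d G_def[symmetric] as[of "P + H", symmetric] asH[symmetric] by (rule bexE)
  have H: "altsum (p - 1) H = (-1) ^ half"
    unfolding H_def using half_less by (intro altsum_of_nat) simp
  have "cg 3 (altsum (p - 1) (P + H) - (-1) ^ half) ((-1) ^ half * (1 + 4 * P ^ 2 * altharm2 half) - (-1) ^ half)"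
    unfolding P_def H_def by (intro cg_diff cg_refl altsum_p_add assms half_less)
  also have "altsum (p - 1) (P + H) - (-1) ^ half = of_nat p ^ 2 * (2 * G + 4 * P ^ 2 * c)"
    unfolding c(2) H unfolding P_def by (simp add: power2_eq_square algebra_simps)
  also have "(-1) ^ half * (1 + 4 * P ^ 2 * altharm2 half) - (-1) ^ half =
      of_nat p ^ 2 * (2 * (2 * (-1) ^ half * altharm2 half))"
    unfolding P_def by (simp add: power2_eq_square algebra_simps)
  finally have "cg (2 + 1) (of_nat p ^ 2 * (2 * G + 4 * P ^ 2 * c)) (of_nat p ^ 2 * (2 * (2 * (-1) ^ half * altharm2 half)))"
    by simp
  then have 1: "cg 1 (2 * G + 4 * P ^ 2 * c) (2 * (2 * (-1) ^ half * altharm2 half))"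
    unfolding cg_power_mult_iff .
  have "cg 1 (2 * G) (2 * G + 4 * P ^ 2 * c)"
  proof (rule cgI)
    show "- (4 * P * c) \<in> Z" using c(1) unfolding P_def by (intro Z_minus Z_mult Z_numeral Z_of_nat)
  qed (simp add: P_def power2_eq_square)
  then have "cg 1 (of_nat 2 * G) (of_nat 2 * (2 * (-1) ^ half * altharm2 half))"
    using cg_trans[OF _ 1] by simp
  then show ?thesis unfolding G_def by (rule cg_cancel) (rule not_dvd_2)
qed

lemma binsum_hcoeff_deriv_pred_p:
  assumes "p > 3"
  shows "cg 1 (binsum (hcoeff_deriv half_param) (p - 1)) (2 * (-1) ^ half * altharm2 half :: 'a::field_char_0)"
proof -
  have "cg 1 (binsum (hcoeff_deriv half_param) (p - 1)) (\<Sum>k<p. hcoeff_deriv half_param k * (-1) ^ k :: 'a)"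
    unfolding binsum_pred_p
    by (intro cg_sum cg_scale cg_choose_p1 hcoeff_deriv_Z half_param_Z) auto
  from cg_trans[OF this altsum_hcoeff_deriv[OF assms]] show ?thesis .
qed

section \<open>The sums of squares modulo \<open>p^3\<close>\<close>

text \<open>This is \<open>christoffel_darboux\<close> at \<open>N = p\<close>. Because of the
  prefactor \<open>p^2\<close>, the terms of index below \<open>p\<close> in \<open>S p\<close> and
  \<open>T p\<close> matter only modulo \<open>p\<close>, where just \<open>k = 0\<close> survives
  and contributes \<open>1\<close> and \<open>0\<close>. The terms of index \<open>p\<close> are
  kept exact, since they may have \<open>p\<close> in the denominator.\<close>

lemma sum_squares_cong:
  fixes m :: "'a::field_char_0"
  assumes "m \<in> Z"
  shows "cg 3 (\<Sum>x<p. (binsum (hcoeff m) x)\<^sup>2)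
    (of_nat p ^ 2 * hcoeff_deriv m p * binsum (hcoeff m) (p - 1) -
     of_nat p ^ 2 * (1 + hcoeff m p) * binsum (hcoeff_deriv m) (p - 1))"
proof -
  have "cg 1 (\<Sum>k<p. hcoeff_deriv m k * of_nat (p choose k)) (\<Sum>k<p. hcoeff_deriv m k * 0)"
  proof (rule cg_sum)
    fix k assume k: "k \<in> {..<p}"
    show "cg 1 (hcoeff_deriv m k * of_nat (p choose k)) (hcoeff_deriv m k * 0)"
    proof (cases "k = 0")
      case False
      then show ?thesis using k assms by (intro cg_scale cg_choose_p hcoeff_deriv_Z) auto
    qed simp
  qed
  then obtain b where b: "b \<in> Z" "(\<Sum>k<p. hcoeff_deriv m k * of_nat (p choose k)) = of_nat p * b"
    by (auto elim!: cgE)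
  have "cg 1 (\<Sum>k<p. hcoeff m k * of_nat (p choose k)) (\<Sum>k<p. if k = 0 then 1 else 0)"
  proof (rule cg_sum)
    fix k assume k: "k \<in> {..<p}"
    show "cg 1 (hcoeff m k * of_nat (p choose k)) (if k = 0 then 1 else 0)"
    proof (cases "k = 0")
      case False
      then have "cg 1 (hcoeff m k * of_nat (p choose k)) (hcoeff m k * 0)"
        using k assms by (intro cg_scale cg_choose_p hcoeff_Z) auto
      then show ?thesis using False by simp
    qed simp
  qed
  also have "(\<Sum>k<p. if k = 0 then 1 else 0) = (1 :: 'a)"
    using gt_2 by simp
  finally obtain a where a: "a \<in> Z" "(\<Sum>k<p. hcoeff m k * of_nat (p choose k)) = 1 + of_nat p * a"
    by (auto elim!: cgE)
  have Z: "binsum (hcoeff m) (p - 1) \<in> Z" "binsum (hcoeff_deriv m) (p - 1) \<in> Z"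
    by (intro binsum_hcoeff_Z binsum_hcoeff_deriv_Z assms pred_p_less)+
  show ?thesis
    unfolding christoffel_darboux binsum_p a(2) b(2)
  proof (rule cgI)
    show "b * binsum (hcoeff m) (p - 1) - a * binsum (hcoeff_deriv m) (p - 1) \<in> Z"
      using a(1) b(1) Z by (intro Z_diff Z_mult)
  qed (simp add: power2_eq_square power3_eq_cube algebra_simps)
qed

text \<open>To second order in \<open>p\<close>, \<open>B\<close> is \<open>exp (2 p h)\<close> and
  \<open>S\<close> is \<open>s (exp (- 2 p h) + 2 p^2 e)\<close>. Hence \<open>B S\<close> is
  \<open>s (1 + 2 p^2 e)\<close>, and the term with \<open>T\<close> removes exactly
  \<open>2 p^2 s e\<close>.\<close>

lemma sum_squares_half_param:
  assumes "p > 3"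
  shows "cg 3 (\<Sum>x<p. (binsum (hcoeff half_param) x)\<^sup>2) ((-1) ^ half :: 'a::field_char_0)"
proof -
  define P s h e :: 'a where "P = of_nat p" and "s = (-1) ^ half" and "h = harm half"
    and "e = altharm2 half"
  define B S T :: 'a where "B = of_nat p ^ 2 * hcoeff_deriv half_param p"
    and "S = binsum (hcoeff half_param) (p - 1)" and "T = binsum (hcoeff_deriv half_param) (p - 1)"
  have Z: "P \<in> Z" "s \<in> Z" "h \<in> Z" "e \<in> Z"
    unfolding P_def s_def h_def e_def
    by (intro Z_of_nat Z_power Z_minus Z_1 harm_Z altharm2_Z half_less)+
  have B: "cg 3 B (1 + 2 * P * h + 2 * P ^ 2 * h ^ 2)"
    unfolding B_def P_def h_def by (rule hcoeff_deriv_half_param_p)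
  have S: "cg 3 S (s * (1 - 2 * P * h + P ^ 2 * (2 * h ^ 2 + 2 * e)))"
    unfolding S_def P_def h_def e_def s_def by (rule binsum_pred_p_cong) (rule half_less)
  have "cg (2 + 1) (of_nat p ^ 2 * T) (of_nat p ^ 2 * (2 * s * e))"
    unfolding cg_power_mult_iff T_def s_def e_def by (rule binsum_hcoeff_deriv_pred_p) fact
  then have T: "cg 3 (P ^ 2 * T) (P ^ 2 * (2 * s * e))" by (simp add: P_def)
  have SZ: "S \<in> Z" unfolding S_def by (intro binsum_hcoeff_Z half_param_Z pred_p_less)
  have "cg 3 (\<Sum>x<p. (binsum (hcoeff half_param) x)\<^sup>2) (B * S - P ^ 2 * T)"
    using sum_squares_cong[OF half_param_Z, where 'a='a]
    by (simp add: hcoeff_half_param_p B_def S_def T_def P_def)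
  also have "cg 3 \<dots> ((1 + 2 * P * h + 2 * P ^ 2 * h ^ 2) *
      (s * (1 - 2 * P * h + P ^ 2 * (2 * h ^ 2 + 2 * e))) - P ^ 2 * (2 * s * e))"
    by (rule cg_diff[OF cg_mult[OF B S _ SZ] T]) (use Z in \<open>intro Z_add Z_mult Z_power Z_numeral Z_1\<close>)
  also have "cg 3 \<dots> s"
  proof (rule cgI)
    show "s * (4 * h * e + 2 * P * h ^ 2 * (2 * h ^ 2 + 2 * e)) \<in> Z"
      using Z by (intro Z_add Z_mult Z_power Z_numeral)
    show "(1 + 2 * P * h + 2 * P ^ 2 * h ^ 2) *
      (s * (1 - 2 * P * h + P ^ 2 * (2 * h ^ 2 + 2 * e))) - P ^ 2 * (2 * s * e) =
      s + of_nat p ^ 3 * (s * (4 * h * e + 2 * P * h ^ 2 * (2 * h ^ 2 + 2 * e)))"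
      unfolding P_def[symmetric] by algebra
  qed
  finally show ?thesis unfolding s_def .
qed

text \<open>Moving \<open>m\<close> by \<open>d = - p^2 / 4\<close> leaves \<open>B\<close> and
  \<open>T\<close> unchanged to the precision needed, adds \<open>d T\<close> to \<open>S\<close>,
  and lowers the weight of \<open>p^2 T\<close> from \<open>1\<close> to \<open>3 / 4\<close>. Since
  \<open>B\<close> is \<open>1\<close> modulo \<open>p\<close>, the two changes cancel.\<close>

lemma sum_squares_minus_quarter:
  assumes "p > 3"
  shows "cg 3 (\<Sum>x<p. (binsum (hcoeff (- 1 / 4)) x)\<^sup>2) ((-1) ^ half :: 'a::field_char_0)"
proof -
  define P r :: 'a where "P = of_nat p" and "r = 1 / 4"
  define d where "d = - (P ^ 2 * r)"
  define B S T :: 'a where "B = of_nat p ^ 2 * hcoeff_deriv half_param p"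
    and "S = binsum (hcoeff half_param) (p - 1)" and "T = binsum (hcoeff_deriv half_param) (p - 1)"
  define B1 S1 T1 A1 :: 'a where "B1 = of_nat p ^ 2 * hcoeff_deriv (- 1 / 4) p"
    and "S1 = binsum (hcoeff (- 1 / 4)) (p - 1)" and "T1 = binsum (hcoeff_deriv (- 1 / 4)) (p - 1)"
    and "A1 = hcoeff (- 1 / 4) p"
  have r4: "4 * r = 1" by (simp add: r_def)
  have PZ: "P \<in> Z" "r \<in> Z" unfolding P_def r_def by (intro Z_of_nat Z_divide_4 Z_1)+
  have d: "- 1 / 4 - half_param = d" "half_param - (- 1 / 4) = - d"
    using half_param_eq[where 'a='a] by (simp_all add: d_def P_def r_def algebra_simps)
  have d0: "d \<noteq> 0" using gt_2 by (simp add: d_def P_def r_def)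
  have BSTZ: "T \<in> Z" "S1 \<in> Z" "T1 \<in> Z"
    unfolding T_def S1_def T1_def
    by (intro binsum_hcoeff_Z binsum_hcoeff_deriv_Z half_param_Z minus_quarter_Z pred_p_less)+
  obtain c where c: "c \<in> Z" "S1 = S + d * T + d\<^sup>2 * c"
    using sum_hcoeff_taylor[of "- 1 / 4 :: 'a" half_param "\<lambda>k. of_nat ((p - 1) choose k)",
        OF minus_quarter_Z half_param_Z Z_of_nat]
    unfolding d binsum_pred_p[symmetric] S_def T_def S1_def by blast
  \<comment> \<open>Expanding in the opposite direction too and adding the equations gives
    \<open>d (T1 - T) = d^2 (c + c')\<close>, which compares the derivatives without a second
    derivative.\<close>
  obtain c' where c': "c' \<in> Z" "S = S1 + (- d) * T1 + (- d)\<^sup>2 * c'"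
    using sum_hcoeff_taylor[of half_param "- 1 / 4 :: 'a" "\<lambda>k. of_nat ((p - 1) choose k)",
        OF half_param_Z minus_quarter_Z Z_of_nat]
    unfolding d binsum_pred_p[symmetric] S_def T1_def S1_def by blast
  have "d * T1 = d * (T + d * (c + c'))" using c(2) c'(2) by algebra
  then have T1: "T1 = T + d * (c + c')" using d0 by simp
  obtain b where b: "b \<in> Z" "B1 = B + P ^ 3 * b"
    using hcoeff_deriv_minus_quarter_p(1)[OF assms, where 'a='a]
    unfolding B_def B1_def P_def by (rule cgE)
  obtain a where a: "a \<in> Z" "A1 = - r + P * a"
    using hcoeff_deriv_minus_quarter_p(2)[OF assms, where 'a='a]
    unfolding A1_def P_def r_def by (rule cgE) simp
  obtain g where g: "g \<in> Z" "B = 1 + P * g"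
    using hcoeff_deriv_half_param_p_mod_p[where 'a='a] unfolding B_def P_def by (rule cgE) simp
  have "cg 3 (\<Sum>x<p. (binsum (hcoeff (- 1 / 4)) x)\<^sup>2) (B1 * S1 - P ^ 2 * (1 + A1) * T1)"
    using sum_squares_cong[OF minus_quarter_Z, where 'a='a]
    by (simp only: B1_def S1_def T1_def A1_def P_def)
  also have "cg 3 \<dots> (B * S - P ^ 2 * T)"
  proof (rule cgI)
    show "b * S1 + P * B * r ^ 2 * c - r * g * T - a * T1 + P * (1 - r) * r * (c + c') \<in> Z"
      unfolding g(2) using PZ BSTZ a(1) b(1) c(1) c'(1) g(1)
      by (intro Z_add Z_diff Z_mult Z_power Z_1)
    show "B1 * S1 - P ^ 2 * (1 + A1) * T1 = B * S - P ^ 2 * T +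
      of_nat p ^ 3 * (b * S1 + P * B * r ^ 2 * c - r * g * T - a * T1 + P * (1 - r) * r * (c + c'))"
      unfolding P_def[symmetric]
      using b(2) a(2) g(2) c(2) T1 r4 d_def by algebra
  qed
  also have "cg 3 \<dots> (\<Sum>x<p. (binsum (hcoeff half_param) x)\<^sup>2)"
    using cg_sym[OF sum_squares_cong[OF half_param_Z, where 'a='a]]
    by (simp add: hcoeff_half_param_p B_def S_def T_def P_def)
  also have "cg 3 \<dots> ((-1) ^ half)"
    by (rule sum_squares_half_param) fact
  finally show ?thesis .
qed

lemma rat_cong_of_cg:
  assumes "cg s a b" "b \<in> \<rat>"
  shows "rat_cong p s a b"
proof -
  obtain c where c: "c \<in> Z" "a = b + of_nat p ^ s * c" using assms(1) by (rule cgE)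
  obtain m n :: int where mn: "n \<noteq> 0" "coprime n (int p)" "c = of_int m / of_int n"
    using c(1) by (auto simp: local_ints_def)
  have "c \<in> \<rat>" unfolding mn by simp
  then have "a \<in> \<rat>" unfolding c(2) using assms(2) by simp
  moreover have "a - b = of_nat p ^ s * (of_int m / of_int n)" unfolding c(2) mn(3) by simp
  ultimately show ?thesis unfolding rat_cong_def using assms(2) mn(1,2) by blast
qed

end

text \<open>For \<open>p = 3\<close> the sums of inverse squares do not vanish modulo
  \<open>p\<close>, so this case is computed directly.\<close>

lemma rat_cong_3:
  "rat_cong 3 3 (\<Sum>x<3. (binsum (hcoeff (- 1 / 4)) x)\<^sup>2) (- 1)"
proof -
  have A: "hcoeff (- 1 / 4) 1 = (- 1 / 4 :: complex)" "hcoeff (- 1 / 4) 2 = (9 / 64 :: complex)"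
    by (simp_all add: hcoeff_def numeral_2_eq_2 power2_eq_square)
  have S: "binsum (hcoeff (- 1 / 4)) 0 = (1 :: complex)" "binsum (hcoeff (- 1 / 4)) 1 = (3 / 4 :: complex)"
    "binsum (hcoeff (- 1 / 4)) 2 = (41 / 64 :: complex)"
    using A by (simp_all add: binsum_def numeral_2_eq_2)
  have sum3: "(\<Sum>x<3. f x) = f 0 + f 1 + f 2" for f :: "nat \<Rightarrow> complex"
    by (simp add: numeral_3_eq_3 numeral_2_eq_2)
  then have sum: "(\<Sum>x<3. (binsum (hcoeff (- 1 / 4)) x)\<^sup>2) = (8081 / 4096 :: complex)"
    unfolding sum3 S by (simp add: power2_eq_square)
  have "coprime (4096 :: int) 3"
    using coprime_power_left_iff[of "2 :: int" 12 3] by simp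
  \<comment> \<open>The witness comes from \<open>8081 + 4096 = 12177 = 27 * 451\<close>.\<close>
  then show ?thesis
    unfolding rat_cong_def sum by (intro conjI exI[of _ "451"] exI[of _ "4096"]) auto
qed

theorem theorem2:
  shows "(\<forall>p :: nat. prime p \<and> p > 3 \<longrightarrow>
            rat_cong p 3
              (\<Sum>x = 0..p - 1.
                 (hyp3F2 ((1 - of_nat p) / 2) ((1 + of_nat p) / 2) (- of_nat x) 1 1 1)\<^sup>2)
              ((- 1) ^ ((p - 1) div 2))) \<and>
         (\<forall>p :: nat. prime p \<and> p \<ge> 3 \<longrightarrow>
            rat_cong p 3
              (\<Sum>x = 0..p - 1. (hyp3F2 (1 / 2) (1 / 2) (- of_nat x) 1 1 1)\<^sup>2)
              ((- 1) ^ ((p - 1) div 2)))"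
proof (intro conjI allI impI)
  fix p :: nat
  assume p: "prime p \<and> p > 3"
  define h where "h = (p - 1) div 2"
  have "odd p" using p by (simp add: prime_odd_nat)
  then interpret odd_prime p h
    using p by unfold_locales (auto simp: h_def elim!: oddE)
  have eq: "- ((1 - of_nat p) / 2) * ((1 + of_nat p) / 2) = (half_param :: complex)"
    unfolding half_param_eq by (simp add: field_simps power2_eq_square)
  have "rat_cong p 3 (\<Sum>x<p. (binsum (hcoeff half_param) x)\<^sup>2) ((- 1) ^ h)"
    using p by (intro rat_cong_of_cg sum_squares_half_param) auto
  moreover have "hyp3F2 ((1 - of_nat p) / 2) ((1 + of_nat p) / 2) (- of_nat x) 1 1 1 =
      binsum (hcoeff half_param) x" for x
    unfolding eq[symmetric] by (rule hyp3F2_eq_binsum) (simp add: field_simps)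
  ultimately show "rat_cong p 3
      (\<Sum>x = 0..p - 1. (hyp3F2 ((1 - of_nat p) / 2) ((1 + of_nat p) / 2) (- of_nat x) 1 1 1)\<^sup>2)
      ((- 1) ^ ((p - 1) div 2))"
    by (simp add: atLeast0AtMost atMost_pred_p[unfolded One_nat_def] h_def)
next
  fix p :: nat
  assume p: "prime p \<and> p \<ge> 3"
  have hyp: "hyp3F2 (1 / 2) (1 / 2) (- of_nat x) 1 1 1 = binsum (hcoeff (- 1 / 4)) x" for x
    using hyp3F2_eq_binsum[of "1 / 2" "1 / 2" x] by simp
  have int: "{0..p - 1} = {..<p}" using p by auto
  show "rat_cong p 3 (\<Sum>x = 0..p - 1. (hyp3F2 (1 / 2) (1 / 2) (- of_nat x) 1 1 1)\<^sup>2)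
      ((- 1) ^ ((p - 1) div 2))"
  proof (cases "p = 3")
    case True
    then show ?thesis unfolding hyp int using rat_cong_3 by simp
  next
    case False
    define h where "h = (p - 1) div 2"
    have "odd p" using p by (simp add: prime_odd_nat)
    then interpret odd_prime p h
      using p by unfold_locales (auto simp: h_def elim!: oddE)
    have "rat_cong p 3 (\<Sum>x<p. (binsum (hcoeff (- 1 / 4)) x)\<^sup>2) ((- 1) ^ h)"
      using p False by (intro rat_cong_of_cg sum_squares_minus_quarter) auto
    then show ?thesis unfolding hyp int h_def .
  qed
qed

end
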